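(* Let $G$ be a finite group acting linearly on a complex vector space $V$ with basis $x_1,\ldots,x_n$, let $\alpha:G\times G\to\mathbb{C}^\times$ be a normalized two-cocycle, and let $q$ be a primitive $\ell$th root of unity with $\ell\ge2$. Let $g$ be a central element of $G$ such that $$g(x_1)=qx_1,\quad g(x_2)=q^{-1}x_2,\quad g(x_3)=x_3,\ \ldots,\ g(x_n)=x_n,$$ and assume that $G$ preserves the subspaces $\mathbb{C}x_1$ and $\mathbb{C}x_2$ of $V$. Let $s\in\mathbb{C}[x_3,\ldots,x_n]$ be nonzero with $h(s)=x_1(h)x_2(h)\alpha(g,h)\alpha^{-1}(h,g)\,s$ for all $h\in G$, and let $D_1,D_2$ be the linear operators on $A=S(V)\#_\alpha G$ defined in the context. Then the Hochschild two-cocycle $\mu_1=m\circ(D_1\otimes D_2)$ on $A$, where $m$ is the multiplication of $A$, is not a coboundary. Consequently the formal deformation of $A$ given by $a*b=\bigl(m\circ\exp_q(tD_1\otimes D_2)\bigr)(a\otimes b)$ for $a,b\in A$, whose infinitesimal is $\mu_1$, is nontrivial.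
   Context: **Crossed product.** A two-cocycle is a function $\alpha:G\times G\to\mathbb{C}^\times$ with $\alpha(g,h)\alpha(gh,k)=\alpha(g,hk)\alpha(h,k)$ for all $g,h,k\in G$; normalized means $\alpha(1,g)=\alpha(g,1)=1$. $G$ acts by algebra automorphisms on the symmetric algebra $S(V)=\mathbb{C}[x_1,\ldots,x_n]$. The crossed product $S(V)\#_\alpha G$ is $S(V)\otimes\mathbb{C}G$ as a vector space, with $r\overline{g}$ denoting $r\otimes g$ and multiplication $(r\overline{g})(s\overline{h})=\alpha(g,h)\,r\,g(s)\,\overline{gh}$. **Characters.** Define functions $x_i:G\to\mathbb{C}^\times$ ($i=1,2$) by $h(x_i)=x_i(h)x_i$ for $h\in G$. **$q$-differentiation.** For $p\in\mathbb{C}^\times$: $(k)_p=1+p+\cdots+p^{k-1}$ for $k\ge1$, $(0)_p=0$, $(k)_p!=(k)_p\cdots(1)_p$, $(0)_p!=1$, and $\partial_{i,p}:S(V)\to S(V)$ is the linear map $\partial_{i,p}(x_1^{k_1}\cdots x_n^{k_n})=(k_i)_p\,x_1^{k_1}\cdots x_{i-1}^{k_{i-1}}x_i^{k_i-1}x_{i+1}^{k_{i+1}}\cdots x_n^{k_n}$. **Operators.** On the basis $\{x_1^{k_1}\cdots x_n^{k_n}\overline{h}\mid k_i\ge0,\ h\in G\}$ of $S(V)\#_\alpha G$, $D_1(x_1^{k_1}\cdots x_n^{k_n}\overline{h})=x_1(h^{-1})\,\partial_{1,q}(x_1^{k_1}\cdots x_n^{k_n})\,\overline{h}$, $D_2(x_1^{k_1}\cdots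 x_n^{k_n}\overline{h})=q^{k_1}\,\partial_{2,q^{-1}}(x_1^{k_1}\cdots x_n^{k_n})\,s\,\overline{g}\cdot\overline{h}$. **The $q$-exponential** (for $q$ a primitive $\ell$th root of unity, $\ell\geq 2$): $\exp_q(y)=\sum_{i=0}^{\ell-1}\frac{1}{(i)_q!}y^i$, so $a*b=\sum_{i=0}^{\ell-1}\frac{t^i}{(i)_q!}D_1^i(a)D_2^i(b)$. **Cocycles and deformations.** A Hochschild two-cocycle on $A$ is a linear map $\mu_1:A\otimes A\to A$ with $\mu_1(a\otimes b)c+\mu_1(ab\otimes c)=\mu_1(a\otimes bc)+a\mu_1(b\otimes c)$; it is a coboundary if there is a linear $f:A\to A$ with $\mu_1(a\otimes b)=af(b)-f(ab)+f(a)b$. A formal deformation of $A$ is an associative $\mathbb{C}[[t]]$-algebra structure on $A[[t]]$ with $a*b=ab+\mu_1(a\otimes b)t+\mu_2(a\otimes b)t^2+\cdots$ for $a,b\in A$, the $\mu_i$ being $\mathbb{C}$-linear and extended $\mathbb{C}[[t]]$-linearly; $\mu_1$ is its infinitesimal. It is trivial if it is isomorphic to $A[[t]]$ with the $\mathbb{C}[[t]]$-bilinear extension of the original product via a $\mathbb{C}[[t]]$-algebra isomorphism congruent to the identity modulo $t$; otherwise nontrivial. *)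

theory Defs
  imports
    "HOL-Library.Poly_Mapping"
    "HOL-Algebra.Module"
    "HOL-Algebra.Group_Action"
    "HOL-Computational_Algebra.Formal_Power_Series"
begin

section \<open>Hochschild cocycles and formal deformations\<close>

text \<open>
  A complex algebra is given by a record of type \<^typ>\<open>(complex, 'a) module\<close>: a ring together with a
  scalar multiplication. (The locale \<^locale>\<open>algebra\<close> is not used, since it requires
  commutativity.) Linear maps on \<open>A \<otimes> A\<close> are represented by bilinear maps on \<open>A \<times> A\<close>.
\<close>

definition linear_endo :: "(complex, 'a, 'm) module_scheme \<Rightarrow> ('a \<Rightarrow> 'a) \<Rightarrow> bool"
  where "linear_endo A f \<longleftrightarrow>
    f \<in> carrier A \<rightarrow> carrier A \<and>
    (\<forall>a\<in>carrier A. \<forall>b\<in>carrier A. f (a \<oplus>\<^bsub>A\<^esub> b) = f a \<oplus>\<^bsub>A\<^esub> f b) \<and>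
    (\<forall>c. \<forall>a\<in>carrier A. f (c \<odot>\<^bsub>A\<^esub> a) = c \<odot>\<^bsub>A\<^esub> f a)"

definition bilinear_op :: "(complex, 'a, 'm) module_scheme \<Rightarrow> ('a \<Rightarrow> 'a \<Rightarrow> 'a) \<Rightarrow> bool"
  where "bilinear_op A \<mu> \<longleftrightarrow>
    (\<forall>a\<in>carrier A. linear_endo A (\<lambda>b. \<mu> a b)) \<and>
    (\<forall>b\<in>carrier A. linear_endo A (\<lambda>a. \<mu> a b))"

definition hochschild_two_cocycle :: "(complex, 'a, 'm) module_scheme \<Rightarrow> ('a \<Rightarrow> 'a \<Rightarrow> 'a) \<Rightarrow> bool"
  where "hochschild_two_cocycle A \<mu> \<longleftrightarrow>
    bilinear_op A \<mu> \<and>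
    (\<forall>a\<in>carrier A. \<forall>b\<in>carrier A. \<forall>c\<in>carrier A.
       (\<mu> a b \<otimes>\<^bsub>A\<^esub> c) \<oplus>\<^bsub>A\<^esub> \<mu> (a \<otimes>\<^bsub>A\<^esub> b) c = \<mu> a (b \<otimes>\<^bsub>A\<^esub> c) \<oplus>\<^bsub>A\<^esub> (a \<otimes>\<^bsub>A\<^esub> \<mu> b c))"

definition hochschild_two_coboundary :: "(complex, 'a, 'm) module_scheme \<Rightarrow> ('a \<Rightarrow> 'a \<Rightarrow> 'a) \<Rightarrow> bool"
  where "hochschild_two_coboundary A \<mu> \<longleftrightarrow>
    (\<exists>f. linear_endo A f \<and>
      (\<forall>a\<in>carrier A. \<forall>b\<in>carrier A.
        \<mu> a b = ((a \<otimes>\<^bsub>A\<^esub> f b) \<ominus>\<^bsub>A\<^esub> f (a \<otimes>\<^bsub>A\<^esub> b)) \<oplus>\<^bsub>A\<^esub> (f a \<otimes>\<^bsub>A\<^esub> b)))"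

text \<open>The \<open>\<complex>[[t]]\<close>-module \<open>A[[t]]\<close>: the sequence \<open>a\<close> stands for \<open>\<Sum>k. a k t^k\<close>.\<close>

definition series_carrier :: "(complex, 'a, 'm) module_scheme \<Rightarrow> (nat \<Rightarrow> 'a) set"
  where "series_carrier A = (UNIV \<rightarrow> carrier A)"

definition series_add ::
  "(complex, 'a, 'm) module_scheme \<Rightarrow> (nat \<Rightarrow> 'a) \<Rightarrow> (nat \<Rightarrow> 'a) \<Rightarrow> nat \<Rightarrow> 'a"
  where "series_add A a b = (\<lambda>k. a k \<oplus>\<^bsub>A\<^esub> b k)"

definition series_smult ::
  "(complex, 'a, 'm) module_scheme \<Rightarrow> complex fps \<Rightarrow> (nat \<Rightarrow> 'a) \<Rightarrow> nat \<Rightarrow> 'a"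
  where "series_smult A c a = (\<lambda>k. \<Oplus>\<^bsub>A\<^esub>i\<in>{..k}. fps_nth c i \<odot>\<^bsub>A\<^esub> a (k - i))"

text \<open>
  The \<open>\<complex>[[t]]\<close>-bilinear extension to \<open>A[[t]]\<close> of the product
  \<open>(a, b) \<mapsto> \<Sum>k. \<mu> k a b t^k\<close> of elements of \<open>A\<close>. It is the only one:
  \<open>\<complex>[[t]]\<close>-bilinearity makes the coefficient of \<open>t^k\<close> in a product depend only on the two
  factors modulo \<open>t^(k+1)\<close>.
\<close>

definition star ::
  "(complex, 'a, 'm) module_scheme \<Rightarrow> (nat \<Rightarrow> 'a \<Rightarrow> 'a \<Rightarrow> 'a) \<Rightarrow> (nat \<Rightarrow> 'a) \<Rightarrow> (nat \<Rightarrow> 'a) \<Rightarrow> nat \<Rightarrow> 'a"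
  where "star A \<mu> a b =
    (\<lambda>k. \<Oplus>\<^bsub>A\<^esub>p\<in>{(i, j). i + j \<le> k}. \<mu> (k - fst p - snd p) (a (fst p)) (b (snd p)))"

definition formal_deformation ::
  "(complex, 'a, 'm) module_scheme \<Rightarrow> (nat \<Rightarrow> 'a \<Rightarrow> 'a \<Rightarrow> 'a) \<Rightarrow> bool"
  where "formal_deformation A \<mu> \<longleftrightarrow>
    (\<forall>a\<in>carrier A. \<forall>b\<in>carrier A. \<mu> 0 a b = a \<otimes>\<^bsub>A\<^esub> b) \<and>
    (\<forall>k. bilinear_op A (\<mu> k)) \<and>
    (\<forall>a\<in>series_carrier A. \<forall>b\<in>series_carrier A. \<forall>c\<in>series_carrier A.
       star A \<mu> (star A \<mu> a b) c = star A \<mu> a (star A \<mu> b c))"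

definition undeformed :: "(complex, 'a, 'm) module_scheme \<Rightarrow> nat \<Rightarrow> 'a \<Rightarrow> 'a \<Rightarrow> 'a"
  where "undeformed A k a b = (if k = 0 then a \<otimes>\<^bsub>A\<^esub> b else \<zero>\<^bsub>A\<^esub>)"

definition infinitesimal :: "(nat \<Rightarrow> 'a \<Rightarrow> 'a \<Rightarrow> 'a) \<Rightarrow> 'a \<Rightarrow> 'a \<Rightarrow> 'a"
  where "infinitesimal \<mu> = \<mu> 1"

text \<open>The last conjunct says that \<open>\<Phi>\<close> is congruent to the identity modulo \<open>t\<close>.\<close>

definition trivial_deformation ::
  "(complex, 'a, 'm) module_scheme \<Rightarrow> (nat \<Rightarrow> 'a \<Rightarrow> 'a \<Rightarrow> 'a) \<Rightarrow> bool"
  where "trivial_deformation A \<mu> \<longleftrightarrow>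
    (\<exists>\<Phi>. bij_betw \<Phi> (series_carrier A) (series_carrier A) \<and>
      (\<forall>a\<in>series_carrier A. \<forall>b\<in>series_carrier A.
         \<Phi> (series_add A a b) = series_add A (\<Phi> a) (\<Phi> b)) \<and>
      (\<forall>c. \<forall>a\<in>series_carrier A. \<Phi> (series_smult A c a) = series_smult A c (\<Phi> a)) \<and>
      (\<forall>a\<in>series_carrier A. \<forall>b\<in>series_carrier A.
         \<Phi> (star A \<mu> a b) = star A (undeformed A) (\<Phi> a) (\<Phi> b)) \<and>
      (\<forall>a\<in>series_carrier A. \<Phi> a 0 = a 0))"

section \<open>Primitive roots of unity and q-analogues\<close>

definition primitive_root_of_unity :: "nat \<Rightarrow> complex \<Rightarrow> bool"
  where "primitive_root_of_unity l q \<longleftrightarrow> 0 < l \<and> q ^ l = 1 \<and> (\<forall>k. 0 < k \<and> k < l \<longrightarrow> q ^ k \<noteq> 1)"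

definition q_num :: "complex \<Rightarrow> nat \<Rightarrow> complex"
  where "q_num p k = (\<Sum>i<k. p ^ i)"

definition q_fact :: "complex \<Rightarrow> nat \<Rightarrow> complex"
  where "q_fact p k = (\<Prod>i=1..k. q_num p i)"

text \<open>The coefficient of \<open>t^k\<close> in \<open>(m \<circ> exp_q (t D1 \<otimes> D2)) (a \<otimes> b)\<close>, for \<open>q\<close> of order \<open>l\<close>.\<close>

definition q_exp_product ::
  "(complex, 'a, 'm) module_scheme \<Rightarrow> nat \<Rightarrow> complex \<Rightarrow> ('a \<Rightarrow> 'a) \<Rightarrow> ('a \<Rightarrow> 'a) \<Rightarrow> nat \<Rightarrow> 'a \<Rightarrow> 'a \<Rightarrow> 'a"
  where "q_exp_product A l q D1 D2 k a b =
    (if k < l then (1 / q_fact q k) \<odot>\<^bsub>A\<^esub> ((D1 ^^ k) a \<otimes>\<^bsub>A\<^esub> (D2 ^^ k) b) else \<zero>\<^bsub>A\<^esub>)"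

section \<open>The symmetric algebra\<close>

text \<open>
  \<open>S(V) = \<complex>[x_1, \<dots>, x_n]\<close>, with the basis of \<open>V\<close> indexed by the finite type \<open>'n\<close>; a monomial is
  its exponent vector.
\<close>

type_synonym 'n monomial = "'n \<Rightarrow>\<^sub>0 nat"
type_synonym 'n sym_alg = "'n monomial \<Rightarrow>\<^sub>0 complex"

definition mono_poly :: "'n monomial \<Rightarrow> 'n sym_alg"
  where "mono_poly k = Poly_Mapping.single k 1"

definition pscale :: "complex \<Rightarrow> 'n sym_alg \<Rightarrow> 'n sym_alg"
  where "pscale c p = Poly_Mapping.single 0 c * p"

definition q_deriv :: "'n \<Rightarrow> complex \<Rightarrow> 'n sym_alg \<Rightarrow> 'n sym_alg"
  where "q_deriv i p r =
    (\<Sum>k\<in>Poly_Mapping.keys r. pscale (Poly_Mapping.lookup r k)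
       (pscale (q_num p (Poly_Mapping.lookup k i)) (mono_poly (k - Poly_Mapping.single i 1))))"

text \<open>The embedding of \<open>V\<close> (with basis \<open>x\<close>) into \<open>S(V)\<close>, and the extension of an action
  \<open>\<phi>\<close> on \<open>V\<close> to \<open>S(V)\<close> by algebra automorphisms.\<close>

definition sym_embed ::
  "(complex \<Rightarrow> 'v::ab_group_add \<Rightarrow> 'v) \<Rightarrow> ('n::finite \<Rightarrow> 'v) \<Rightarrow> 'v \<Rightarrow> 'n sym_alg"
  where "sym_embed scale x v =
    (\<Sum>i\<in>UNIV. pscale (Modules.module.representation scale (range x) v (x i))
       (mono_poly (Poly_Mapping.single i 1)))"

definition sym_action ::
  "(complex \<Rightarrow> 'v::ab_group_add \<Rightarrow> 'v) \<Rightarrow> ('n::finite \<Rightarrow> 'v) \<Rightarrow> ('g \<Rightarrow> 'v \<Rightarrow> 'v) \<Rightarrow>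
    'g \<Rightarrow> 'n sym_alg \<Rightarrow> 'n sym_alg"
  where "sym_action scale x \<phi> h r =
    (\<Sum>k\<in>Poly_Mapping.keys r. pscale (Poly_Mapping.lookup r k)
       (\<Prod>i\<in>UNIV. sym_embed scale x (\<phi> h (x i)) ^ Poly_Mapping.lookup k i))"

text \<open>The scalar by which \<open>h\<close> acts on an eigenvector \<open>v\<close>.\<close>

definition character_on ::
  "(complex \<Rightarrow> 'v \<Rightarrow> 'v) \<Rightarrow> ('g \<Rightarrow> 'v \<Rightarrow> 'v) \<Rightarrow> 'v \<Rightarrow> 'g \<Rightarrow> complex"
  where "character_on scale \<phi> v h = (THE c. \<phi> h v = scale c v)"

section \<open>The crossed product\<close>

definition normalized_two_cocycle :: "('g, 'm) monoid_scheme \<Rightarrow> ('g \<Rightarrow> 'g \<Rightarrow> complex) \<Rightarrow> bool"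
  where "normalized_two_cocycle G \<alpha> \<longleftrightarrow>
    (\<forall>g\<in>carrier G. \<forall>h\<in>carrier G. \<alpha> g h \<noteq> 0) \<and>
    (\<forall>g\<in>carrier G. \<forall>h\<in>carrier G. \<forall>k\<in>carrier G.
       \<alpha> g h * \<alpha> (g \<otimes>\<^bsub>G\<^esub> h) k = \<alpha> g (h \<otimes>\<^bsub>G\<^esub> k) * \<alpha> h k) \<and>
    (\<forall>g\<in>carrier G. \<alpha> \<one>\<^bsub>G\<^esub> g = 1 \<and> \<alpha> g \<one>\<^bsub>G\<^esub> = 1)"

text \<open>
  The element \<open>r \<otimes> g\<close> of \<open>S(V) \<otimes> \<complex>G\<close> is \<open>Poly_Mapping.single g r\<close>; \<open>act\<close> is the action of \<open>G\<close>
  on \<open>S(V)\<close>.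
\<close>

type_synonym ('g, 'n) crossed = "'g \<Rightarrow>\<^sub>0 'n sym_alg"

definition crossed_scale :: "complex \<Rightarrow> ('g, 'n) crossed \<Rightarrow> ('g, 'n) crossed"
  where "crossed_scale c a = Poly_Mapping.map (pscale c) a"

definition crossed_product ::
  "('g, 'm) monoid_scheme \<Rightarrow> ('g \<Rightarrow> 'g \<Rightarrow> complex) \<Rightarrow> ('g \<Rightarrow> 'n sym_alg \<Rightarrow> 'n sym_alg) \<Rightarrow>
    (complex, ('g, 'n) crossed) module"
  where "crossed_product G \<alpha> act =
    \<lparr> carrier = {a. Poly_Mapping.keys a \<subseteq> carrier G},
      monoid.mult = (\<lambda>a b. \<Sum>g\<in>Poly_Mapping.keys a. \<Sum>h\<in>Poly_Mapping.keys b.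
        Poly_Mapping.single (g \<otimes>\<^bsub>G\<^esub> h)
          (pscale (\<alpha> g h) (Poly_Mapping.lookup a g * act g (Poly_Mapping.lookup b h)))),
      one = Poly_Mapping.single \<one>\<^bsub>G\<^esub> 1,
      zero = 0,
      add = (+),
      smult = crossed_scale \<rparr>"

text \<open>The linear map with value \<open>B k h\<close> on the basis element \<open>x^k \<otimes> h\<close>.\<close>

definition crossed_extend ::
  "('n monomial \<Rightarrow> 'g \<Rightarrow> ('g, 'n) crossed) \<Rightarrow> ('g, 'n) crossed \<Rightarrow> ('g, 'n) crossed"
  where "crossed_extend B a =
    (\<Sum>h\<in>Poly_Mapping.keys a. \<Sum>k\<in>Poly_Mapping.keys (Poly_Mapping.lookup a h).
       crossed_scale (Poly_Mapping.lookup (Poly_Mapping.lookup a h) k) (B k h))"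

definition D1_op ::
  "('g, 'm) monoid_scheme \<Rightarrow> ('g \<Rightarrow> complex) \<Rightarrow> complex \<Rightarrow> 'n \<Rightarrow>
    ('g, 'n) crossed \<Rightarrow> ('g, 'n) crossed"
  where "D1_op G \<chi>1 q i1 = crossed_extend (\<lambda>k h.
    Poly_Mapping.single h (pscale (\<chi>1 (inv\<^bsub>G\<^esub> h)) (q_deriv i1 q (mono_poly k))))"

definition D2_op ::
  "(complex, ('g, 'n) crossed, 'm) module_scheme \<Rightarrow> complex \<Rightarrow> 'g \<Rightarrow> 'n sym_alg \<Rightarrow> 'n \<Rightarrow> 'n \<Rightarrow>
    ('g, 'n) crossed \<Rightarrow> ('g, 'n) crossed"
  where "D2_op A q g s i1 i2 = crossed_extend (\<lambda>k h.
    Poly_Mapping.single g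
      (pscale (q ^ Poly_Mapping.lookup k i1) (q_deriv i2 (inverse q) (mono_poly k)) * s)
    \<otimes>\<^bsub>A\<^esub> Poly_Mapping.single h 1)"

end

(*
  Put sigma(x^k) = q^(k_1) x^k and Sigma(r h) = chi_1(h^-1) sigma(r) h. Then D1 and D2 are skew
  derivations of opposite handedness for the same automorphism,
    D1(ab) = D1(a) Sigma(b) + a D1(b),    D2(ab) = D2(a) b + Sigma(a) D2(b);
  the condition on s is exactly what makes the twist in the second rule equal Sigma. Moreover
  D1 and D2 commute, each q-commutes with Sigma, and their l-th powers vanish. The first two rules
  make mu_1 a cocycle, and the q-binomial theorem turns both bracketings of a triple product into
  the same triple sum. If mu_1 were the coboundary of f, then antisymmetrizing at (x_1, x_2) would give
  s g = [x_1, f(x_2)] + [f(x_1), x_2], so that, comparing the coefficients of g, s would lie in the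
  ideal (x_1, x_2). Finally, an isomorphism trivializing a deformation exhibits, in degree one, its
  infinitesimal as a coboundary.
*)
theory Submission
  imports Defs
begin

section \<open>Linear maps on the symmetric algebra\<close>

text \<open>The Leibniz rules of q-derivatives on S(V) do not carry over to A by themselves: moving
  h past a polynomial applies the action of h, and D2 moves the component at h to the one at gh.
  Each factor in the data repairs one defect. The scalar chi_1(h^-1) in D1 cancels the eigenvalue
  picked up when the q-derivative crosses h. The factor q^(k_1) in D2 completes the twist x_2 ->
  q^-1 x_2 to the full action of g, which the element g in D2 produces when it passes a polynomial.
  The ratio of values of \<alpha> in the condition on s pays for exchanging gh and hg. For the
  q-derivatives to be eigenvectors under G, no h may send another variable to a form involving x_1
  or x_2. Only two lines are assumed stable; the rest follows from centrality of g, whose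
  eigenvalues q and q^-1 differ from 1. At a root of unity (n)_q! vanishes for n \<ge> l, so the
  usual exponential argument is available only below l; beyond it, nilpotency must make the
  remaining terms vanish.\<close>

lemma vector_space_pscale: "vector_space (pscale :: complex \<Rightarrow> 'n sym_alg \<Rightarrow> 'n sym_alg)"
  by unfold_locales
    (auto simp: pscale_def algebra_simps single_add mult_single simp flip: mult.assoc)

interpretation sym: vector_space "pscale :: complex \<Rightarrow> 'n sym_alg \<Rightarrow> 'n sym_alg"
  by (rule vector_space_pscale)

lemma pscale_mult_left [simp]: "pscale c p * r = pscale c (p * r)"
  and pscale_mult_right [simp]: "p * pscale c r = pscale c (p * r)"
  by (simp_all add: pscale_def ac_simps)

lemma lookup_pscale [simp]: "Poly_Mapping.lookup (pscale c p) k = c * Poly_Mapping.lookup p k"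
proof -
  have "pscale c p = Poly_Mapping.map ((*) c) p"
    by (simp add: pscale_def mult_map_scale_conv_mult)
  thus ?thesis
    by (simp add: Poly_Mapping.map.rep_eq when_def)
qed

lemma mono_poly_add: "mono_poly (k + k') = mono_poly k * mono_poly k'"
  by (simp add: mono_poly_def mult_single)

lemma mono_poly_0 [simp]: "mono_poly 0 = 1"
  by (simp add: mono_poly_def)

lemma sym_alg_expand:
  "r = (\<Sum>k\<in>Poly_Mapping.keys r. pscale (Poly_Mapping.lookup r k) (mono_poly k))"
  by (rule poly_mapping_eqI)
    (auto simp: lookup_sum mono_poly_def lookup_single when_def in_keys_iff mult_delta_right)

text \<open>\<open>q_deriv\<close>, \<open>q_shift\<close> and the action on S(V) all have this
  shape, so their linearity is proved once.\<close>

definition linear_extension ::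
  "('n monomial \<Rightarrow> 'n sym_alg) \<Rightarrow> 'n sym_alg \<Rightarrow> 'n sym_alg"
  where "linear_extension B r =
    (\<Sum>k\<in>Poly_Mapping.keys r. pscale (Poly_Mapping.lookup r k) (B k))"

lemma linear_linear_extension: "Vector_Spaces.linear pscale pscale (linear_extension B)"
proof -
  have add: "linear_extension B (p + r) = linear_extension B p + linear_extension B r" for p r
    unfolding linear_extension_def by (rule setsum_keys_plus_distrib) (auto simp: sym.scale_left_distrib)
  have "linear_extension B (pscale c p) = pscale c (linear_extension B p)" for c p
  \<comment> \<open>Scaling by 0 empties the support over which the extension sums; any other scalar
    preserves it.\<close>
  proof (cases "c = 0")
    case True thus ?thesis by (simp add: linear_extension_def)
  next
    case False
    hence "Poly_Mapping.keys (pscale c p) = Poly_Mapping.keys p"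
      by (auto simp: in_keys_iff)
    thus ?thesis by (simp add: linear_extension_def sym.scale_sum_right)
  qed
  with add show ?thesis
    by unfold_locales auto
qed

lemma linear_extension_mono [simp]: "linear_extension B (mono_poly k) = B k"
  by (simp add: linear_extension_def mono_poly_def)

lemma linear_eq_on_monomials:
  assumes f: "Vector_Spaces.linear pscale pscale f" and f': "Vector_Spaces.linear pscale pscale f'"
    and eq: "\<And>k. f (mono_poly k) = f' (mono_poly k)"
  shows "f r = (f' r :: 'n sym_alg)"
proof -
  interpret f: Vector_Spaces.linear pscale pscale f by fact
  interpret f': Vector_Spaces.linear pscale pscale f' by fact
  show ?thesis
    by (subst (1 2) sym_alg_expand) (simp add: f.sum f'.sum f.scale f'.scale eq)
qed

lemma linear_compose_sym:
  "Vector_Spaces.linear pscale pscale f \<Longrightarrow> Vector_Spaces.linear pscale pscale f' \<Longrightarrow>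
    Vector_Spaces.linear pscale pscale (\<lambda>r. f (f' r :: 'n sym_alg) :: 'n sym_alg)"
  using Vector_Spaces.linear_compose[of pscale pscale f' pscale f] by (simp add: o_def)

lemma linear_mult_right_sym: "Vector_Spaces.linear pscale pscale (\<lambda>r. r * (p :: 'n sym_alg))"
  by unfold_locales (auto simp: algebra_simps)

lemma linear_mult_left_sym: "Vector_Spaces.linear pscale pscale (\<lambda>r. (p :: 'n sym_alg) * r)"
  by unfold_locales (auto simp: algebra_simps)

lemma linear_add_sym:
  "Vector_Spaces.linear pscale pscale f \<Longrightarrow> Vector_Spaces.linear pscale pscale f' \<Longrightarrow>
    Vector_Spaces.linear pscale pscale (\<lambda>r. f r + f' r :: 'n sym_alg)"
  by (auto simp: Vector_Spaces.linear_iff algebra_simps)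

lemma linear_scale_sym:
  "Vector_Spaces.linear pscale pscale f \<Longrightarrow>
    Vector_Spaces.linear pscale pscale (\<lambda>r. pscale c (f r) :: 'n sym_alg)"
  by (rule linear_compose_sym[OF sym.linear_scale_self])

lemma bilinear_eq_on_monomials:
  fixes f f' :: "'n sym_alg \<Rightarrow> 'n sym_alg \<Rightarrow> 'n sym_alg"
  assumes "\<And>r. Vector_Spaces.linear pscale pscale (f r)" "\<And>r. Vector_Spaces.linear pscale pscale (\<lambda>p. f p r)"
    and "\<And>r. Vector_Spaces.linear pscale pscale (f' r)" "\<And>r. Vector_Spaces.linear pscale pscale (\<lambda>p. f' p r)"
    and "\<And>k k'. f (mono_poly k) (mono_poly k') = f' (mono_poly k) (mono_poly k')"
  shows "f p r = f' p r"
proof (rule linear_eq_on_monomials[where f = "f p" and f' = "f' p"])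
  show "f p (mono_poly k) = f' p (mono_poly k)" for k
    by (rule linear_eq_on_monomials[where f = "\<lambda>p. f p (mono_poly k)"
        and f' = "\<lambda>p. f' p (mono_poly k)"]) (use assms in auto)
qed (use assms in auto)

text \<open>Identities between algebra maps or skew derivations pass to products, so the variables
  suffice. This suits the action of G, which is simple on a variable but sends a monomial to a
  product of linear forms.\<close>

lemma sym_alg_induct [case_names const var add mult]:
  fixes r :: "'n sym_alg"
  assumes const: "\<And>c. P (pscale c 1)"
    and var: "\<And>i. P (mono_poly (Poly_Mapping.single i 1))"
    and add: "\<And>p r. P p \<Longrightarrow> P r \<Longrightarrow> P (p + r)"
    and mult: "\<And>p r. P p \<Longrightarrow> P r \<Longrightarrow> P (p * r)"
  shows "P r"
proof -
  have single: "P (mono_poly (Poly_Mapping.single i n))" for i n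
  proof (induction n)
    case 0 show ?case using const[of 1] by simp
  next
    case (Suc n)
    have "mono_poly (Poly_Mapping.single i (Suc n)) =
        (mono_poly (Poly_Mapping.single i 1) * mono_poly (Poly_Mapping.single i n) :: 'n sym_alg)"
      by (simp flip: mono_poly_add single_add)
    thus ?case using mult[OF var Suc.IH] by metis
  qed
  have mono: "P (mono_poly k)" for k :: "'n monomial"
  proof (induction k rule: update_induct)
    case const show ?case using assms(1)[of 1] by simp
  next
    case (update k i n)
    \<comment> \<open>The induction sets exponents at fresh indices only, so overwriting is
      addition.\<close>
    have "Poly_Mapping.update i n k = Poly_Mapping.single i n + k"
      using update by (intro poly_mapping_eqI) (auto simp: lookup_update lookup_add lookup_single in_keys_iff)
    thus ?case using mult[OF single update(3)] by (simp add: mono_poly_add)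
  qed
  have scaled: "P (pscale c (mono_poly k))" for c k
    using mult[OF assms(1)[of c] mono[of k]] by simp
  have "P (\<Sum>k\<in>K. pscale (c k) (mono_poly k))" if "finite K" for K c
    using that by induction (use assms(1)[of 0] add scaled in auto)
  from this[OF finite_keys] show ?thesis
    by (subst sym_alg_expand)
qed

section \<open>Skew derivations of the symmetric algebra\<close>

lemma q_num_0 [simp]: "q_num p 0 = 0"
  by (simp add: q_num_def)

lemma q_num_1 [simp]: "q_num p (Suc 0) = 1"
  by (simp add: q_num_def)

lemma q_num_add: "q_num p (m + n) = q_num p m + p ^ m * q_num p n"
  by (induction n) (simp_all add: q_num_def algebra_simps power_add)

lemma q_num_eq: "p \<noteq> 1 \<Longrightarrow> q_num p n = (p ^ n - 1) / (p - 1)"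
  by (simp add: q_num_def geometric_sum)

lemma q_num_root_of_unity:
  assumes "primitive_root_of_unity l q" "l \<ge> 2"
  shows "q \<noteq> 1" "0 < n \<Longrightarrow> n < l \<Longrightarrow> q_num q n \<noteq> 0" "l dvd n \<Longrightarrow> q_num q n = 0"
    "l dvd n \<Longrightarrow> q_num (inverse q) n = 0"
proof -
  have "q ^ 1 \<noteq> 1"
    using assms unfolding primitive_root_of_unity_def by (metis less_le_trans one_less_numeral_iff semiring_norm(76) zero_less_one)
  thus q: "q \<noteq> 1" by simp
  show "0 < n \<Longrightarrow> n < l \<Longrightarrow> q_num q n \<noteq> 0"
    using q assms by (simp add: q_num_eq primitive_root_of_unity_def)
  show "l dvd n \<Longrightarrow> q_num q n = 0" "l dvd n \<Longrightarrow> q_num (inverse q) n = 0"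
    using q assms by (auto simp: q_num_eq primitive_root_of_unity_def power_mult power_inverse)
qed

text \<open>The automorphism x_i -> p x_i, which is the twist in the Leibniz rule of
  \<open>q_deriv i p\<close>.\<close>

definition q_shift :: "'n \<Rightarrow> complex \<Rightarrow> 'n sym_alg \<Rightarrow> 'n sym_alg"
  where "q_shift i p =
    linear_extension (\<lambda>k. pscale (p ^ Poly_Mapping.lookup k i) (mono_poly k))"

lemma q_deriv_eq: "q_deriv i p = linear_extension
    (\<lambda>k. pscale (q_num p (Poly_Mapping.lookup k i)) (mono_poly (k - Poly_Mapping.single i 1)))"
  by (simp add: fun_eq_iff q_deriv_def linear_extension_def)

lemma q_deriv_mono: "q_deriv i p (mono_poly k) =
    pscale (q_num p (Poly_Mapping.lookup k i)) (mono_poly (k - Poly_Mapping.single i 1))"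
  by (simp add: q_deriv_eq)

lemma q_shift_mono: "q_shift i p (mono_poly k) = pscale (p ^ Poly_Mapping.lookup k i) (mono_poly k)"
  by (simp add: q_shift_def)

lemma linear_q_deriv: "Vector_Spaces.linear pscale pscale (q_deriv i p)"
  and linear_q_shift: "Vector_Spaces.linear pscale pscale (q_shift i p)"
  by (simp_all add: q_deriv_eq q_shift_def linear_linear_extension)

interpretation q_deriv: Vector_Spaces.linear pscale pscale "q_deriv i p" for i p
  by (rule linear_q_deriv)

interpretation q_shift: Vector_Spaces.linear pscale pscale "q_shift i p" for i p
  by (rule linear_q_shift)

lemmas linear_sym_intros = sym.linear_ident linear_add_sym linear_scale_sym
  linear_compose_sym[OF linear_q_deriv] linear_compose_sym[OF linear_q_shift]
  linear_compose_sym[OF linear_mult_left_sym] linear_compose_sym[OF linear_mult_right_sym]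

lemma q_shift_mult: "q_shift i p (r * r') = q_shift i p r * q_shift i p r'"
  by (rule bilinear_eq_on_monomials[where f = "\<lambda>r r'. q_shift i p (r * r')"])
    (auto intro!: linear_sym_intros
      simp: q_shift_mono lookup_add power_add mult.commute simp flip: mono_poly_add)

text \<open>Exponents are subtracted with truncation, so the two monomials can differ when x_i does
  not occur in \<open>k\<close>; the coefficient is then \<open>q_num p 0 = 0\<close>.\<close>

lemma q_deriv_mono_times:
  "pscale (q_num p (Poly_Mapping.lookup k i)) (mono_poly (k - Poly_Mapping.single i 1)) * mono_poly k' =
    pscale (q_num p (Poly_Mapping.lookup k i)) (mono_poly (k + k' - Poly_Mapping.single i 1))"
proof (cases "Poly_Mapping.lookup k i = 0")
  case False
  have "k - Poly_Mapping.single i 1 + k' = k + k' - Poly_Mapping.single i 1"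
    using False by (intro poly_mapping_eqI) (auto simp: lookup_add lookup_minus lookup_single when_def)
  thus ?thesis by (simp flip: mono_poly_add)
qed simp

text \<open>On monomials this is (m + n)_p = (m)_p + p^m (n)_p with m the exponent in the second
  factor; this order of the summands puts the twist on the second factor.\<close>

lemma q_deriv_mult:
  "q_deriv i p (r * r') = q_deriv i p r * q_shift i p r' + r * q_deriv i p r'"
proof (rule bilinear_eq_on_monomials[where f = "\<lambda>r r'. q_deriv i p (r * r')"
      and f' = "\<lambda>r r'. q_deriv i p r * q_shift i p r' + r * q_deriv i p r'"])
  fix k k' :: "'a monomial"
  let ?e = "Poly_Mapping.single i 1"
  have 1: "q_deriv i p (mono_poly k) * mono_poly k' =
      pscale (q_num p (Poly_Mapping.lookup k i)) (mono_poly (k + k' - ?e))"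
    unfolding q_deriv_mono by (rule q_deriv_mono_times)
  have 2: "mono_poly k * q_deriv i p (mono_poly k') =
      pscale (q_num p (Poly_Mapping.lookup k' i)) (mono_poly (k + k' - ?e))"
    unfolding q_deriv_mono using q_deriv_mono_times[of p k' i k] by (simp add: ac_simps)
  have "q_deriv i p (mono_poly k * mono_poly k') =
      pscale (q_num p (Poly_Mapping.lookup k' i + Poly_Mapping.lookup k i)) (mono_poly (k + k' - ?e))"
    unfolding mono_poly_add[symmetric] q_deriv_mono by (simp add: lookup_add add.commute)
  also have "\<dots> = pscale (p ^ Poly_Mapping.lookup k' i) (q_deriv i p (mono_poly k) * mono_poly k') +
      mono_poly k * q_deriv i p (mono_poly k')"
    unfolding 1 2 q_num_add sym.scale_left_distrib by simp
  finally show "q_deriv i p (mono_poly k * mono_poly k') =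
      q_deriv i p (mono_poly k) * q_shift i p (mono_poly k') + mono_poly k * q_deriv i p (mono_poly k')"
    by (simp only: q_shift_mono pscale_mult_right)
qed (intro linear_sym_intros)+

text \<open>The derivative lowers the exponent of x_i by one, so shifting before it yields one more
  factor \<open>p'\<close> than shifting after it.\<close>

lemma q_deriv_q_shift_same:
  "q_deriv i p (q_shift i p' r) = pscale p' (q_shift i p' (q_deriv i p r))"
proof (rule linear_eq_on_monomials[where f = "\<lambda>r. q_deriv i p (q_shift i p' r)"])
  fix k :: "'a monomial"
  show "q_deriv i p (q_shift i p' (mono_poly k)) = pscale p' (q_shift i p' (q_deriv i p (mono_poly k)))"
    by (cases "Poly_Mapping.lookup k i")
      (simp_all add: q_shift_mono q_deriv_mono q_deriv.scale q_shift.scale lookup_minus ac_simps)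
qed (intro linear_sym_intros)+

lemma q_deriv_q_shift_commute:
  "i \<noteq> j \<Longrightarrow> q_deriv i p (q_shift j p' r) = q_shift j p' (q_deriv i p r)"
  by (rule linear_eq_on_monomials[where f = "\<lambda>r. q_deriv i p (q_shift j p' r)"])
    (auto intro!: linear_sym_intros
      simp: q_shift_mono q_deriv_mono q_deriv.scale q_shift.scale lookup_minus lookup_single mult.commute)

lemma q_deriv_commute:
  assumes "i \<noteq> j"
  shows "q_deriv i p (q_deriv j p' r) = q_deriv j p' (q_deriv i p r)"
proof (rule linear_eq_on_monomials[where f = "\<lambda>r. q_deriv i p (q_deriv j p' r)"])
  fix k :: "'a monomial"
  have "k - Poly_Mapping.single j 1 - Poly_Mapping.single i 1 =
      k - Poly_Mapping.single i 1 - Poly_Mapping.single j 1"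
    by (rule poly_mapping_eqI) (auto simp: lookup_minus)
  thus "q_deriv i p (q_deriv j p' (mono_poly k)) = q_deriv j p' (q_deriv i p (mono_poly k))"
    using assms by (simp add: q_deriv_mono q_deriv.scale lookup_minus lookup_single mult.commute)
qed (intro linear_sym_intros)+

lemma q_deriv_one [simp]: "q_deriv i p 1 = 0"
  using q_deriv_mono[of i p 0] by simp

lemma q_shift_one [simp]: "q_shift i p 1 = 1"
  using q_shift_mono[of i p 0] by simp

lemma q_deriv_var: "q_deriv i p (mono_poly (Poly_Mapping.single j 1)) = (if i = j then 1 else 0)"
  by (auto simp: q_deriv_mono lookup_single)

lemma q_shift_var: "q_shift i p (mono_poly (Poly_Mapping.single j 1)) =
    pscale (if i = j then p else 1) (mono_poly (Poly_Mapping.single j 1))"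
  by (simp add: q_shift_mono lookup_single when_def)

definition free_of :: "'n \<Rightarrow> 'n sym_alg \<Rightarrow> bool"
  where "free_of i r \<longleftrightarrow> (\<forall>k\<in>Poly_Mapping.keys r. Poly_Mapping.lookup k i = 0)"

lemma q_shift_free_of: "free_of i r \<Longrightarrow> q_shift i p r = r"
proof -
  assume "free_of i r"
  hence "q_shift i p r = (\<Sum>k\<in>Poly_Mapping.keys r. pscale (Poly_Mapping.lookup r k) (mono_poly k))"
    unfolding q_shift_def linear_extension_def by (intro sum.cong) (auto simp: free_of_def)
  thus ?thesis by (simp flip: sym_alg_expand)
qed

lemma q_deriv_free_of: "free_of i r \<Longrightarrow> q_deriv i p r = 0"
  unfolding q_deriv_def free_of_def by (auto intro!: sum.neutral)

lemma q_deriv_mult_free_of: "free_of i s \<Longrightarrow> q_deriv i p (r * s) = q_deriv i p r * s"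
  by (simp add: q_deriv_mult q_shift_free_of q_deriv_free_of)

lemma q_deriv_funpow_mono:
  "(q_deriv i p ^^ n) (mono_poly k) =
    pscale (\<Prod>j<n. q_num p (Poly_Mapping.lookup k i - j)) (mono_poly (k - Poly_Mapping.single i n))"
proof (induction n)
  case (Suc n)
  have "k - Poly_Mapping.single i n - Poly_Mapping.single i 1 = k - Poly_Mapping.single i (Suc n)"
    by (rule poly_mapping_eqI) (auto simp: lookup_minus lookup_single when_def)
  with Suc show ?case
    by (simp add: q_deriv.scale q_deriv_mono lookup_minus)
qed simp

lemma linear_funpow_sym:
  "Vector_Spaces.linear pscale pscale f \<Longrightarrow> Vector_Spaces.linear pscale pscale (f ^^ n :: 'n sym_alg \<Rightarrow> 'n sym_alg)"
proof (induction n)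
  case 0 show ?case using sym.linear_id by (simp add: id_def)
next
  case (Suc n) thus ?case using linear_compose_sym[of f "f ^^ n"] by (simp add: o_def)
qed

text \<open>The l successive derivatives contribute the factors (k_i - j)_p for j < l. At j = k_i
  mod l the index is a multiple of l, and the factor vanishes.\<close>

lemma q_deriv_nilpotent:
  assumes l: "l > 0" and zero: "\<And>n. l dvd n \<Longrightarrow> q_num p n = 0"
  shows "(q_deriv i p ^^ l) r = 0"
proof (rule linear_eq_on_monomials[where f = "q_deriv i p ^^ l" and f' = "\<lambda>_. 0"])
  fix k :: "'a monomial"
  have "\<exists>j<l. q_num p (Poly_Mapping.lookup k i - j) = 0"
    using l by (intro exI[of _ "Poly_Mapping.lookup k i mod l"] conjI zero dvd_minus_mod) simp
  thus "(q_deriv i p ^^ l) (mono_poly k) = 0"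
    unfolding q_deriv_funpow_mono by auto
next
  show "Vector_Spaces.linear pscale pscale (q_deriv i p ^^ l)"
    by (rule linear_funpow_sym[OF linear_q_deriv])
  show "Vector_Spaces.linear pscale pscale (\<lambda>_. 0)"
    by (simp add: Vector_Spaces.linear_iff vector_space_pscale)
qed

text \<open>The images of the other variables are fixed by the shift in x_i and killed by the
  q-derivative, which settles the variables. Products follow from multiplicativity of
  \<open>T\<close>; for the derivative, the twisted Leibniz rule also calls on the claim about the
  shift.\<close>

lemma
  fixes T :: "'n sym_alg \<Rightarrow> 'n sym_alg"
  assumes T: "Vector_Spaces.linear pscale pscale T"
    and one: "T 1 = 1" and mult: "\<And>p r. T (p * r) = T p * T r"
    and eigen: "T (mono_poly (Poly_Mapping.single i 1)) = pscale c (mono_poly (Poly_Mapping.single i 1))"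
    and free: "\<And>j. j \<noteq> i \<Longrightarrow> free_of i (T (mono_poly (Poly_Mapping.single j 1)))"
  shows q_shift_equivariant: "q_shift i p (T r) = T (q_shift i p r)"
    and q_deriv_equivariant: "q_deriv i p (T r) = pscale c (T (q_deriv i p r))"
proof -
  interpret T: Vector_Spaces.linear pscale pscale T by fact
  show shift: "q_shift i p (T r) = T (q_shift i p r)" for r
  proof (induction r rule: sym_alg_induct)
    case (var j)
    show ?case
      using eigen free[of j]
      by (cases "j = i") (auto simp: q_shift_var T.scale q_shift.scale q_shift_free_of mult.commute simp del: One_nat_def)
  qed (auto simp: T.scale q_shift.scale one T.add q_shift.add q_shift_mult mult)
  show "q_deriv i p (T r) = pscale c (T (q_deriv i p r))"
  proof (induction r rule: sym_alg_induct)
    case (var j)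
    show ?case
      using eigen free[of j]
      by (cases "j = i") (auto simp: q_deriv_var one T.zero q_deriv.scale q_deriv_free_of simp del: One_nat_def)
  qed (auto simp: T.scale q_deriv.scale one T.zero T.add q_deriv.add q_deriv_mult mult shift
      sym.scale_right_distrib)
qed

section \<open>The action on the symmetric algebra\<close>

locale finite_basis = vector_space scale
  for scale :: "complex \<Rightarrow> 'v::ab_group_add \<Rightarrow> 'v" +
  fixes x :: "'n::finite \<Rightarrow> 'v"
  assumes inj_basis: "inj x" and independent_basis: "independent (range x)"
    and span_basis: "span (range x) = UNIV"
begin

definition coord :: "'v \<Rightarrow> 'n \<Rightarrow> complex"
  where "coord v i = representation (range x) v (x i)"

lemma coord_add: "coord (u + v) i = coord u i + coord v i"
  by (simp add: coord_def representation_add independent_basis span_basis)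

lemma coord_scale: "coord (scale c v) i = c * coord v i"
  by (simp add: coord_def representation_scale independent_basis span_basis)

lemma coord_basis: "coord (x j) i = (if i = j then 1 else 0)"
  using inj_basis by (simp add: coord_def representation_basis independent_basis inj_eq)

lemma coord_expand: "v = (\<Sum>i\<in>UNIV. scale (coord v i) (x i))"
proof -
  have "(\<Sum>b\<in>range x. scale (representation (range x) v b) b) = v"
    by (rule sum_representation_eq) (auto simp: independent_basis span_basis)
  thus ?thesis
    using inj_basis by (simp add: coord_def sum.reindex)
qed

abbreviation "to_sym \<equiv> sym_embed scale x"

lemma to_sym_eq: "to_sym v = (\<Sum>i\<in>UNIV. pscale (coord v i) (mono_poly (Poly_Mapping.single i 1)))"
  by (simp add: sym_embed_def coord_def)

lemma linear_to_sym: "Vector_Spaces.linear scale pscale to_sym"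
  by unfold_locales
    (auto simp: to_sym_eq coord_add coord_scale sym.scale_left_distrib sum.distrib sym.scale_sum_right)

lemma to_sym_basis: "to_sym (x j) = mono_poly (Poly_Mapping.single j 1)"
proof -
  have "to_sym (x j) = (\<Sum>i\<in>UNIV. if i = j then mono_poly (Poly_Mapping.single i 1) else 0)"
    unfolding to_sym_eq by (intro sum.cong) (auto simp: coord_basis)
  thus ?thesis by simp
qed

lemma free_of_to_sym: "coord v i = 0 \<Longrightarrow> free_of i (to_sym v)"
  unfolding free_of_def
proof (intro ballI, rule ccontr)
  fix k assume v: "coord v i = 0" and k: "k \<in> Poly_Mapping.keys (to_sym v)"
    and "Poly_Mapping.lookup k i \<noteq> 0"
  hence "k = Poly_Mapping.single j 1 \<Longrightarrow> coord v j = 0" for j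
    by (cases "j = i") (auto simp: lookup_single)
  hence "Poly_Mapping.lookup (to_sym v) k = 0"
    unfolding to_sym_eq lookup_sum by (intro sum.neutral) (auto simp: mono_poly_def lookup_single when_def)
  with k show False by (simp add: in_keys_iff)
qed

end

locale linear_group_action = finite_basis scale x + group G + group_action G UNIV \<phi>
  for scale :: "complex \<Rightarrow> 'v::ab_group_add \<Rightarrow> 'v" and x :: "'n::finite \<Rightarrow> 'v"
    and G :: "('g, 'm) monoid_scheme" (structure) and \<phi> +
  assumes linear_action: "h \<in> carrier G \<Longrightarrow> Vector_Spaces.linear scale scale (\<phi> h)"
begin

abbreviation "act \<equiv> sym_action scale x \<phi>"

lemma act_eq: "act h = linear_extension
    (\<lambda>k. \<Prod>i\<in>UNIV. to_sym (\<phi> h (x i)) ^ Poly_Mapping.lookup k i)"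
  by (simp add: fun_eq_iff sym_action_def linear_extension_def)

lemma linear_act: "Vector_Spaces.linear pscale pscale (act h)"
  by (simp add: act_eq linear_linear_extension)

lemma act_one: "act h 1 = 1"
  unfolding act_eq mono_poly_0[symmetric] linear_extension_mono by simp

lemma act_mult: "act h (r * r') = act h r * act h r'"
proof (rule bilinear_eq_on_monomials[where f = "\<lambda>r r'. act h (r * r')"])
  show "act h (mono_poly k * mono_poly k') = act h (mono_poly k) * act h (mono_poly k')" for k k'
    unfolding mono_poly_add[symmetric] act_eq linear_extension_mono
    by (simp add: lookup_add power_add prod.distrib)
qed (intro linear_sym_intros linear_compose_sym[OF linear_act])+

lemma act_var: "act h (mono_poly (Poly_Mapping.single j 1)) = to_sym (\<phi> h (x j))"
proof -
  have "(\<Prod>i\<in>UNIV. to_sym (\<phi> h (x i)) ^ Poly_Mapping.lookup (Poly_Mapping.single j 1) i) =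
      (\<Prod>i\<in>UNIV. if j = i then to_sym (\<phi> h (x i)) else 1)"
    by (intro prod.cong) (auto simp: lookup_single when_def)
  thus ?thesis
    unfolding act_eq linear_extension_mono by (simp only:) simp
qed

lemma act_to_sym:
  assumes "h \<in> carrier G"
  shows "act h (to_sym v) = to_sym (\<phi> h v)"
proof -
  interpret \<phi>: Vector_Spaces.linear scale scale "\<phi> h" using assms by (rule linear_action)
  interpret act: Vector_Spaces.linear pscale pscale "act h" by (rule linear_act)
  interpret to_sym: Vector_Spaces.linear scale pscale to_sym by (rule linear_to_sym)
  have "act h (to_sym v) = (\<Sum>i\<in>UNIV. pscale (coord v i) (to_sym (\<phi> h (x i))))"
    by (simp add: to_sym_eq[of v] act.sum act.scale act_var del: One_nat_def)
  also have "\<dots> = to_sym (\<phi> h (\<Sum>i\<in>UNIV. scale (coord v i) (x i)))"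
    by (simp add: to_sym.sum to_sym.scale \<phi>.sum \<phi>.scale)
  finally show ?thesis by (simp flip: coord_expand)
qed

text \<open>Both sides are algebra maps, so the variables suffice. There \<open>act k\<close> yields
  a linear form instead of a variable, and \<open>act_to_sym\<close> evaluates \<open>act h\<close>
  on it.\<close>

lemma act_act:
  assumes "h \<in> carrier G" "k \<in> carrier G"
  shows "act (h \<otimes> k) r = act h (act k r)"
proof -
  interpret h: Vector_Spaces.linear pscale pscale "act h" by (rule linear_act)
  interpret k: Vector_Spaces.linear pscale pscale "act k" by (rule linear_act)
  interpret hk: Vector_Spaces.linear pscale pscale "act (h \<otimes> k)" by (rule linear_act)
  show ?thesis
  proof (induction r rule: sym_alg_induct)
    case (var i)
    show ?case
      using assms composition_rule[of "x i" h k] by (simp only: act_var act_to_sym UNIV_I)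
  qed (simp_all add: h.scale k.scale hk.scale h.add k.add hk.add act_one act_mult)
qed

lemma act_id: "act \<one> r = r"
proof -
  interpret Vector_Spaces.linear pscale pscale "act \<one>" by (rule linear_act)
  have "\<phi> \<one> v = v" for v
    using id_eq_one by (metis UNIV_I restrict_apply')
  thus ?thesis
    by (induction r rule: sym_alg_induct)
      (simp_all only: act_var to_sym_basis scale act_one add act_mult)
qed

end

section \<open>Formal deformations of embedded algebras\<close>

text \<open>\<open>star\<close> with the sum of the ambient type in place of \<open>finsum\<close>;
  \<open>star_eq\<close> identifies the two on series over the carrier.\<close>

definition series_product :: "(nat \<Rightarrow> 'a \<Rightarrow> 'a \<Rightarrow> 'a::comm_monoid_add) \<Rightarrow> (nat \<Rightarrow> 'a) \<Rightarrow> (nat \<Rightarrow> 'a) \<Rightarrow> nat \<Rightarrow> 'a"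
  where "series_product \<mu> a b k = (\<Sum>(i, j)\<in>{(i, j). i + j \<le> k}. \<mu> (k - i - j) (a i) (b j))"

lemma finite_pairs_le: "finite {(i, j). i + j \<le> (k::nat)}"
  by (rule finite_subset[of _ "{..k} \<times> {..k}"]) auto

lemmas finite_pairs_le' = finite_pairs_le[unfolded split_def]

text \<open>Each side at t^N is a sum over the exponents i, j, r of the three factors and the order
  n of the inner product. For fixed i, j, r the sums over n agree by \<open>assoc\<close> at order N
  - i - j - r. Additivity is assumed for sums over pairs because an assumption cannot be polymorphic
  in the index type.\<close>

lemma series_product_assoc:
  fixes \<mu> :: "nat \<Rightarrow> 'a \<Rightarrow> 'a \<Rightarrow> 'a::comm_monoid_add"
  assumes sum_left: "\<And>n (I :: (nat \<times> nat) set) f c. finite I \<Longrightarrow> f \<in> I \<rightarrow> K \<Longrightarrow> c \<in> K \<Longrightarrow>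
      \<mu> n (sum f I) c = (\<Sum>i\<in>I. \<mu> n (f i) c)"
    and sum_right: "\<And>n (I :: (nat \<times> nat) set) f a. finite I \<Longrightarrow> f \<in> I \<rightarrow> K \<Longrightarrow> a \<in> K \<Longrightarrow>
      \<mu> n a (sum f I) = (\<Sum>i\<in>I. \<mu> n a (f i))"
    and closed: "\<And>n a b. a \<in> K \<Longrightarrow> b \<in> K \<Longrightarrow> \<mu> n a b \<in> K"
    and assoc: "\<And>N a b c. a \<in> K \<Longrightarrow> b \<in> K \<Longrightarrow> c \<in> K \<Longrightarrow>
      (\<Sum>n\<le>N. \<mu> (N - n) (\<mu> n a b) c) = (\<Sum>n\<le>N. \<mu> (N - n) a (\<mu> n b c))"
    and a: "\<And>i. a i \<in> K" and b: "\<And>i. b i \<in> K" and c: "\<And>i. c i \<in> K"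
  shows "series_product \<mu> (series_product \<mu> a b) c = series_product \<mu> a (series_product \<mu> b c)"
proof
  fix N :: nat
  let ?P = "\<lambda>k. {(i, j). i + j \<le> (k::nat)}"
  let ?T = "{(i, j, r). i + j + r \<le> N}"
  have fin: "finite ?T"
    by (rule finite_subset[of _ "{..N} \<times> {..N} \<times> {..N}"]) auto
  have "series_product \<mu> (series_product \<mu> a b) c N =
      (\<Sum>(p, r)\<in>?P N. \<Sum>(i, j)\<in>?P p. \<mu> (N - p - r) (\<mu> (p - i - j) (a i) (b j)) (c r))"
    unfolding series_product_def
    by (intro sum.cong refl) (auto simp: sum_left[OF finite_pairs_le'] closed a b c split_def)
  also have "\<dots> = (\<Sum>((p, r), (i, j))\<in>Sigma (?P N) (\<lambda>(p, r). ?P p).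
      \<mu> (N - p - r) (\<mu> (p - i - j) (a i) (b j)) (c r))"
    using finite_pairs_le by (subst sum.Sigma[symmetric]) (auto simp: split_def)
  \<comment> \<open>The inner product contributes to t^p with p = i + j + n; trading p for n makes n
    the innermost variable.\<close>
  also have "\<dots> = (\<Sum>((i, j, r), n)\<in>Sigma ?T (\<lambda>(i, j, r). {..N - i - j - r}).
      \<mu> (N - i - j - r - n) (\<mu> n (a i) (b j)) (c r))"
    by (rule sum.reindex_bij_witness[where
          i = "\<lambda>((i, j, r), n). ((i + j + n, r), (i, j))" and
          j = "\<lambda>((p, r), (i, j)). ((i, j, r), p - i - j)"]) (auto simp: algebra_simps)
  also have "\<dots> = (\<Sum>(i, j, r)\<in>?T. \<Sum>n\<le>N - i - j - r.
      \<mu> (N - i - j - r - n) (\<mu> n (a i) (b j)) (c r))"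
    using fin by (subst sum.Sigma[symmetric]) (auto simp: split_def)
  also have "\<dots> = (\<Sum>(i, j, r)\<in>?T. \<Sum>n\<le>N - i - j - r.
      \<mu> (N - i - j - r - n) (a i) (\<mu> n (b j) (c r)))"
    by (intro sum.cong refl) (auto simp: assoc[OF a b c] simp del: diff_diff_left)
  also have "\<dots> = (\<Sum>((i, j, r), n)\<in>Sigma ?T (\<lambda>(i, j, r). {..N - i - j - r}).
      \<mu> (N - i - j - r - n) (a i) (\<mu> n (b j) (c r)))"
    using fin by (subst sum.Sigma[symmetric]) (auto simp: split_def)
  also have "\<dots> = (\<Sum>((i, p), (j, r))\<in>Sigma (?P N) (\<lambda>(i, p). ?P p).
      \<mu> (N - i - p) (a i) (\<mu> (p - j - r) (b j) (c r)))"
    by (rule sum.reindex_bij_witness[where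
          j = "\<lambda>((i, j, r), n). ((i, j + r + n), (j, r))" and
          i = "\<lambda>((i, p), (j, r)). ((i, j, r), p - j - r)"]) (auto simp: algebra_simps)
  also have "\<dots> = (\<Sum>(i, p)\<in>?P N. \<Sum>(j, r)\<in>?P p. \<mu> (N - i - p) (a i) (\<mu> (p - j - r) (b j) (c r)))"
    using finite_pairs_le by (subst sum.Sigma[symmetric]) (auto simp: split_def)
  also have "\<dots> = series_product \<mu> a (series_product \<mu> b c) N"
    unfolding series_product_def
    by (intro sum.cong refl) (auto simp: sum_right[OF finite_pairs_le'] closed a b c split_def)
  finally show "series_product \<mu> (series_product \<mu> a b) c N =
      series_product \<mu> a (series_product \<mu> b c) N" .
qed

text \<open>
  The additive structure of the record is that of the ambient type, so that \<open>finsum\<close> and \<open>a_minus\<close>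
  become \<open>sum\<close> and \<open>(-)\<close>. The product is bilinear on the whole type, but associative only on the
  carrier.
\<close>

locale embedded_algebra = vector_space sc
  for sc :: "complex \<Rightarrow> 'a::ab_group_add \<Rightarrow> 'a" +
  fixes A :: "(complex, 'a, 'm) module_scheme" (structure)
  assumes add_eq: "add A = (+)" and zero_eq: "zero A = 0" and smult_eq: "module.smult A = sc"
    and subspace_carrier: "subspace (carrier A)"
    and mult_closed: "a \<in> carrier A \<Longrightarrow> b \<in> carrier A \<Longrightarrow> a \<otimes> b \<in> carrier A"
    and add_mult: "(a + b) \<otimes> c = a \<otimes> c + b \<otimes> c"
    and mult_add: "a \<otimes> (b + c) = a \<otimes> b + a \<otimes> c"
    and scale_mult: "sc z a \<otimes> b = sc z (a \<otimes> b)"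
    and mult_scale: "a \<otimes> sc z b = sc z (a \<otimes> b)"
    and mult_assoc: "a \<in> carrier A \<Longrightarrow> b \<in> carrier A \<Longrightarrow> c \<in> carrier A \<Longrightarrow>
      (a \<otimes> b) \<otimes> c = a \<otimes> (b \<otimes> c)"
begin

lemmas carrier_add = subspace_add[OF subspace_carrier]
  and carrier_zero = subspace_0[OF subspace_carrier]
  and carrier_scale = subspace_scale[OF subspace_carrier]
  and carrier_sum = subspace_sum[OF subspace_carrier]

lemma linear_mult_left: "Vector_Spaces.linear sc sc (\<lambda>b. a \<otimes> b)"
  and linear_mult_right: "Vector_Spaces.linear sc sc (\<lambda>a. a \<otimes> b)"
  by (unfold_locales) (auto simp: add_mult mult_add scale_mult mult_scale)

lemmas mult_sum = module_hom.sum[OF module_hom_linearI[OF linear_mult_left]]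
  and sum_mult = module_hom.sum[OF module_hom_linearI[OF linear_mult_right]]
  and mult_zero = module_hom.zero[OF module_hom_linearI[OF linear_mult_left]]
  and zero_mult = module_hom.zero[OF module_hom_linearI[OF linear_mult_right]]

lemma abelian_group_A: "abelian_group A"
proof (rule abelian_groupI)
  fix x assume "x \<in> carrier A"
  thus "\<exists>y\<in>carrier A. y \<oplus> x = \<zero>"
    using subspace_neg[OF subspace_carrier] by (intro bexI[of _ "- x"]) (auto simp: add_eq zero_eq)
qed (auto simp: add_eq zero_eq carrier_add carrier_zero algebra_simps)

sublocale abelian_group A by (rule abelian_group_A)

lemma finsum_eq: "finite I \<Longrightarrow> f \<in> I \<rightarrow> carrier A \<Longrightarrow> finsum A f I = sum f I"
  by (induction I rule: finite_induct) (auto simp: finsum_insert finsum_empty zero_eq add_eq)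

lemma minus_eq_diff: "a \<in> carrier A \<Longrightarrow> b \<in> carrier A \<Longrightarrow> a \<ominus> b = a - b"
  using minus_equality[of "- b" b] subspace_neg[OF subspace_carrier]
  by (simp add: a_minus_def add_eq zero_eq)

lemma linear_endoI:
  "Vector_Spaces.linear sc sc f \<Longrightarrow> f \<in> carrier A \<rightarrow> carrier A \<Longrightarrow> linear_endo A f"
  by (simp add: linear_endo_def add_eq smult_eq Vector_Spaces.linear_iff)

text \<open>Additivity is known on the carrier only, so even f 0 = 0 has to be drawn from
  it.\<close>

lemma linear_endo_sum:
  assumes "linear_endo A f" "finite I" "h \<in> I \<rightarrow> carrier A"
  shows "f (sum h I) = (\<Sum>i\<in>I. f (h i))"
proof -
  have "f (0 + 0) = f 0 + f 0"
    using assms(1) carrier_zero unfolding linear_endo_def add_eq by blast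
  hence "f 0 = 0" by simp
  with assms(2,3) show ?thesis
    using assms(1) by (induction I rule: finite_induct) (auto simp: linear_endo_def add_eq carrier_sum Pi_def)
qed

lemma
  assumes "bilinear_op A m"
  shows bilinear_op_closed: "a \<in> carrier A \<Longrightarrow> b \<in> carrier A \<Longrightarrow> m a b \<in> carrier A"
    and bilinear_op_zero: "a \<in> carrier A \<Longrightarrow> m a 0 = 0" "b \<in> carrier A \<Longrightarrow> m 0 b = 0"
proof -
  show "a \<in> carrier A \<Longrightarrow> b \<in> carrier A \<Longrightarrow> m a b \<in> carrier A"
    using assms by (auto simp: bilinear_op_def linear_endo_def)
  show "a \<in> carrier A \<Longrightarrow> m a 0 = 0" "b \<in> carrier A \<Longrightarrow> m 0 b = 0"
    using assms linear_endo_sum[of "\<lambda>b. m a b" "{}"] linear_endo_sum[of "\<lambda>a. m a b" "{}"]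
    by (auto simp: bilinear_op_def)
qed

lemma star_eq:
  assumes "\<And>n. bilinear_op A (\<mu> n)" "a \<in> series_carrier A" "b \<in> series_carrier A"
  shows "star A \<mu> a b = series_product \<mu> a b"
proof
  fix k
  have "star A \<mu> a b k = (\<Sum>p\<in>{(i, j). i + j \<le> k}. \<mu> (k - fst p - snd p) (a (fst p)) (b (snd p)))"
    unfolding star_def using assms
    by (intro finsum_eq finite_pairs_le) (auto simp: series_carrier_def intro!: bilinear_op_closed[OF assms(1)])
  thus "star A \<mu> a b k = series_product \<mu> a b k"
    by (simp add: series_product_def split_def)
qed

lemma series_product_closed:
  assumes "\<And>n. bilinear_op A (\<mu> n)" "a \<in> series_carrier A" "b \<in> series_carrier A"
  shows "series_product \<mu> a b \<in> series_carrier A"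
  using assms unfolding series_carrier_def series_product_def
  by (auto intro!: carrier_sum bilinear_op_closed[OF assms(1)])

text \<open>Bilinearity reduces associativity on A[[t]] to constant series; \<open>assoc\<close> is
  the coefficient of t^N for these.\<close>

lemma formal_deformationI:
  assumes "\<And>a b. a \<in> carrier A \<Longrightarrow> b \<in> carrier A \<Longrightarrow> \<mu> 0 a b = a \<otimes> b"
    and bilinear: "\<And>n. bilinear_op A (\<mu> n)"
    and assoc: "\<And>N a b c. a \<in> carrier A \<Longrightarrow> b \<in> carrier A \<Longrightarrow> c \<in> carrier A \<Longrightarrow>
      (\<Sum>n\<le>N. \<mu> (N - n) (\<mu> n a b) c) = (\<Sum>n\<le>N. \<mu> (N - n) a (\<mu> n b c))"
  shows "formal_deformation A \<mu>"
proof -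
  have "series_product \<mu> (series_product \<mu> a b) c = series_product \<mu> a (series_product \<mu> b c)"
    if "a \<in> series_carrier A" "b \<in> series_carrier A" "c \<in> series_carrier A" for a b c
  proof (rule series_product_assoc[where K = "carrier A"])
    show "\<mu> n (sum f I) c = (\<Sum>i\<in>I. \<mu> n (f i) c)"
      if "finite I" "f \<in> I \<rightarrow> carrier A" "c \<in> carrier A" for n and I :: "(nat \<times> nat) set" and f c
      using that bilinear[of n] linear_endo_sum[of "\<lambda>a. \<mu> n a c" I f] by (simp add: bilinear_op_def)
    show "\<mu> n a (sum f I) = (\<Sum>i\<in>I. \<mu> n a (f i))"
      if "finite I" "f \<in> I \<rightarrow> carrier A" "a \<in> carrier A" for n and I :: "(nat \<times> nat) set" and f a
      using that bilinear[of n] linear_endo_sum[of "\<lambda>b. \<mu> n a b" I f] by (simp add: bilinear_op_def)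
  qed (use that assoc bilinear_op_closed[OF bilinear] in \<open>auto simp: series_carrier_def\<close>)
  thus ?thesis
    unfolding formal_deformation_def
    using assms(1) bilinear by (simp add: star_eq series_product_closed)
qed

lemma bilinear_undeformed: "bilinear_op A (undeformed A n)"
  unfolding bilinear_op_def linear_endo_def undeformed_def
  by (auto simp: add_eq zero_eq smult_eq carrier_zero mult_closed add_mult mult_add scale_mult
      mult_scale)

text \<open>On constants \<Phi>(a) = a + t f(a) + ..., and the coefficient of t in the
  multiplicativity of \<Phi> reads f(ab) + \<mu>_1(a, b) = a f(b) + f(a) b. The left side evaluates
  \<Phi> at the nonconstant series a * b, which is where linearity over t enters.\<close>

lemma coboundary_if_trivial:
  assumes \<mu>: "formal_deformation A \<mu>" and triv: "trivial_deformation A \<mu>"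
  shows "hochschild_two_coboundary A (\<mu> 1)"
proof -
  have bilinear: "bilinear_op A (\<mu> n)" for n
    using \<mu> by (auto simp: formal_deformation_def)
  obtain \<Phi> where \<Phi>: "\<Phi> \<in> series_carrier A \<rightarrow> series_carrier A"
    and add: "\<And>a b. a \<in> series_carrier A \<Longrightarrow> b \<in> series_carrier A \<Longrightarrow>
      \<Phi> (series_add A a b) = series_add A (\<Phi> a) (\<Phi> b)"
    and smult: "\<And>c a. a \<in> series_carrier A \<Longrightarrow> \<Phi> (series_smult A c a) = series_smult A c (\<Phi> a)"
    and mult: "\<And>a b. a \<in> series_carrier A \<Longrightarrow> b \<in> series_carrier A \<Longrightarrow>
      \<Phi> (star A \<mu> a b) = star A (undeformed A) (\<Phi> a) (\<Phi> b)"
    and \<Phi>_0: "\<And>a. a \<in> series_carrier A \<Longrightarrow> \<Phi> a 0 = a 0"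
    using triv unfolding trivial_deformation_def by (auto dest: bij_betw_imp_funcset)
  define \<iota> :: "'a \<Rightarrow> nat \<Rightarrow> 'a" where "\<iota> a = (\<lambda>k. if k = 0 then a else 0)" for a
  define f where "f a = \<Phi> (\<iota> a) 1" for a
  have \<iota>: "\<iota> a \<in> series_carrier A" if "a \<in> carrier A" for a
    using that carrier_zero by (auto simp: series_carrier_def \<iota>_def)
  have \<Phi>_closed: "\<Phi> a k \<in> carrier A" if "a \<in> series_carrier A" for a k
    using \<Phi> that by (auto simp: series_carrier_def Pi_def)
  have smult_sum: "series_smult A c a k = (\<Sum>i\<le>k. sc (fps_nth c i) (a (k - i)))"
    if "a \<in> series_carrier A" for c a k
    unfolding series_smult_def smult_eq using that
    by (intro finsum_eq) (auto simp: series_carrier_def intro!: carrier_scale)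
  have smult_const: "series_smult A (fps_const c) a = (\<lambda>k. sc c (a k))"
    if a: "a \<in> series_carrier A" for c a
  proof
    fix k
    have "series_smult A (fps_const c) a k = (\<Sum>i\<le>k. if i = 0 then sc c (a k) else 0)"
      unfolding smult_sum[OF a] by (intro sum.cong) auto
    thus "series_smult A (fps_const c) a k = sc c (a k)" by simp
  qed
  have smult_X: "series_smult A fps_X a = (\<lambda>k. if k = 0 then 0 else a (k - 1))"
    if a: "a \<in> series_carrier A" for a
  proof
    fix k
    have "series_smult A fps_X a k = (\<Sum>i\<le>k. if i = 1 then a (k - 1) else 0)"
      unfolding smult_sum[OF a] by (intro sum.cong) (auto simp: fps_X_def)
    thus "series_smult A fps_X a k = (if k = 0 then 0 else a (k - 1))" by auto
  qed
  have f_closed: "f a \<in> carrier A" if "a \<in> carrier A" for a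
    using \<Phi>_closed[OF \<iota>[OF that]] by (simp add: f_def)
  have f_linear: "linear_endo A f"
    unfolding linear_endo_def
  proof (intro conjI ballI allI)
    fix a b c assume a: "a \<in> carrier A" and b: "b \<in> carrier A"
    have "\<iota> (a + b) = series_add A (\<iota> a) (\<iota> b)"
      by (auto simp: \<iota>_def series_add_def add_eq)
    with add[OF \<iota>[OF a] \<iota>[OF b]] show "f (a \<oplus> b) = f a \<oplus> f b"
      by (simp add: f_def series_add_def add_eq)
    have "\<iota> (sc c a) = series_smult A (fps_const c) (\<iota> a)"
      unfolding smult_const[OF \<iota>[OF a]] by (auto simp: \<iota>_def)
    moreover have "\<Phi> (\<iota> a) \<in> series_carrier A"
      using \<Phi> \<iota>[OF a] by auto
    ultimately show "f (c \<odot> a) = c \<odot> f a"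
      using smult[OF \<iota>[OF a], of "fps_const c"] by (simp add: f_def smult_const smult_eq)
  qed (use f_closed in auto)
  \<comment> \<open>Write \<open>a = a 0 + t a'\<close>; the coefficient of \<open>t\<close> in \<open>t \<Phi>(a')\<close> is \<open>a' 0 = a 1\<close>.\<close>
  have \<Phi>_1: "\<Phi> a 1 = f (a 0) + a 1" if a: "a \<in> series_carrier A" for a
  proof -
    define a' where "a' k = a (Suc k)" for k
    have a': "a' \<in> series_carrier A" and a0: "a 0 \<in> carrier A"
      using a by (auto simp: series_carrier_def a'_def)
    hence X: "series_smult A fps_X a' \<in> series_carrier A" and \<Phi>a': "\<Phi> a' \<in> series_carrier A"
      using \<Phi> by (auto simp: smult_X series_carrier_def carrier_zero)
    have "a = series_add A (\<iota> (a 0)) (series_smult A fps_X a')"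
      unfolding smult_X[OF a'] by (auto simp: series_add_def add_eq \<iota>_def a'_def)
    hence "\<Phi> a 1 = (series_add A (\<Phi> (\<iota> (a 0))) (series_smult A fps_X (\<Phi> a'))) 1"
      using add[OF \<iota>[OF a0] X] smult[OF a'] by metis
    thus ?thesis
      using \<Phi>_0[OF a'] by (simp add: series_add_def add_eq f_def smult_X[OF \<Phi>a'] a'_def)
  qed
  have "\<mu> 1 a b = a \<otimes> f b - f (a \<otimes> b) + f a \<otimes> b" if a: "a \<in> carrier A" and b: "b \<in> carrier A" for a b
  proof -
    have star: "star A \<mu> (\<iota> a) (\<iota> b) k = \<mu> k a b" for k
    proof -
      have "star A \<mu> (\<iota> a) (\<iota> b) k = (\<Sum>p\<in>{(i, j). i + j \<le> k}. if p = (0, 0) then \<mu> k a b else 0)"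
        unfolding star_eq[OF bilinear \<iota>[OF a] \<iota>[OF b]] series_product_def
        by (intro sum.cong refl) (auto simp: \<iota>_def bilinear_op_zero[OF bilinear] a b carrier_zero split: if_splits)
      thus ?thesis using finite_pairs_le[of k] by (simp add: sum.delta)
    qed
    have 1: "{(i, j). i + j \<le> (1::nat)} = {(0, 0), (0, 1), (1, 0)}"
      by auto
    have \<Phi>\<iota>: "\<Phi> (\<iota> a) \<in> series_carrier A" "\<Phi> (\<iota> b) \<in> series_carrier A"
      using \<Phi> \<iota> a b by auto
    have "star A (undeformed A) (\<Phi> (\<iota> a)) (\<Phi> (\<iota> b)) 1 = a \<otimes> f b + f a \<otimes> b"
      unfolding star_eq[OF bilinear_undeformed \<Phi>\<iota>] series_product_def 1
      using \<Phi>_0[OF \<iota>[OF a]] \<Phi>_0[OF \<iota>[OF b]]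
      by (simp add: undeformed_def zero_eq f_def) (simp add: \<iota>_def)
    moreover have "star A \<mu> (\<iota> a) (\<iota> b) \<in> series_carrier A"
      using a b bilinear_op_closed[OF bilinear] by (auto simp: series_carrier_def star)
    ultimately have "f (\<mu> 0 a b) + \<mu> 1 a b = a \<otimes> f b + f a \<otimes> b"
      using \<Phi>_1[of "star A \<mu> (\<iota> a) (\<iota> b)"] mult[OF \<iota>[OF a] \<iota>[OF b]] by (simp add: star)
    thus ?thesis
      using \<mu> a b by (simp add: formal_deformation_def algebra_simps)
  qed
  thus ?thesis
    unfolding hochschild_two_coboundary_def
    using f_linear by (intro exI[of _ f]) (simp add: add_eq minus_eq_diff mult_closed f_closed)
qed

end

section \<open>The q-exponential of a pair of commuting skew derivations\<close>

text \<open>Gaussian binomial coefficients by the q-Pascal rule: at a root of unity the q-factorials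
  in the quotient formula may vanish.\<close>

fun q_binom :: "complex \<Rightarrow> nat \<Rightarrow> nat \<Rightarrow> complex" where
  "q_binom q n 0 = 1"
| "q_binom q 0 (Suc i) = 0"
| "q_binom q (Suc n) (Suc i) = q_binom q n i + q ^ Suc i * q_binom q n (Suc i)"

lemma q_binom_eq_0: "n < i \<Longrightarrow> q_binom q n i = 0"
  by (induction q n i rule: q_binom.induct) auto

lemma q_binom_self: "q_binom q n n = 1"
  by (induction n) (simp_all add: q_binom_eq_0)

lemma q_fact_0 [simp]: "q_fact q 0 = 1"
  and q_fact_Suc: "q_fact q (Suc n) = q_fact q n * q_num q (Suc n)"
  by (simp_all add: q_fact_def)

text \<open>The quotient formula with denominators cleared, which makes it valid for every q. The
  q-Pascal rule splits the left side, and the parts recombine by (i + j)_q = (i)_q + q^i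
  (j)_q.\<close>

lemma q_binom_fact: "q_binom q (i + j) i * (q_fact q i * q_fact q j) = q_fact q (i + j)"
proof (induction "i + j" arbitrary: i j)
  case (Suc n)
  show ?case
  proof (cases i)
    case (Suc i')
    note i = this
    show ?thesis
    proof (cases j)
      case (Suc j')
      have IH1: "q_binom q n i' * (q_fact q i' * q_fact q j) = q_fact q n"
        and IH2: "q_binom q n i * (q_fact q i * q_fact q j') = q_fact q n"
        using Suc.hyps(1)[of i' j] Suc.hyps(1)[of i j'] Suc.hyps(2) i Suc by simp_all
      have "q_binom q (i + j) i * (q_fact q i * q_fact q j) =
          (q_binom q n i' * (q_fact q i' * q_fact q j)) * q_num q i +
          q ^ i * q_num q j * (q_binom q n i * (q_fact q i * q_fact q j'))"
        unfolding Suc.hyps(2)[symmetric] using i Suc by (simp add: q_fact_Suc algebra_simps)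
      also have "\<dots> = q_fact q n * q_num q (Suc n)"
        unfolding IH1 IH2 Suc.hyps(2) q_num_add by (simp add: algebra_simps)
      finally show ?thesis
        unfolding Suc.hyps(2)[symmetric] q_fact_Suc .
    qed (simp add: q_binom_self)
  qed simp
qed simp

lemma q_fact_nonzero:
  assumes "primitive_root_of_unity l q" "l \<ge> 2" "n < l"
  shows "q_fact q n \<noteq> 0"
  using assms(3) by (induction n) (auto simp: q_fact_Suc q_num_root_of_unity(2)[OF assms(1,2)])

lemma q_fact_zero:
  assumes "primitive_root_of_unity l q" "l \<ge> 2" "l \<le> n"
  shows "q_fact q n = 0"
  unfolding q_fact_def
  using assms(2,3) q_num_root_of_unity(3)[OF assms(1,2), of l] by (intro prod_zero) auto

lemma q_binom_eq:
  assumes "primitive_root_of_unity l q" "l \<ge> 2" "n < l" "i \<le> n"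
  shows "1 / q_fact q n * q_binom q n i = 1 / q_fact q i * (1 / q_fact q (n - i))"
  using q_binom_fact[of q i "n - i"] assms q_fact_nonzero[OF assms(1,2), of n]
    q_fact_nonzero[OF assms(1,2), of i] q_fact_nonzero[OF assms(1,2), of "n - i"]
  by (simp add: field_simps)

text \<open>Induction step of the q-binomial theorem in a form that serves both skew derivations:
  applying one of them turns T i j into T (i + 1) j + q^i T i (j + 1).\<close>

lemma q_leibniz_step:
  fixes scale :: "complex \<Rightarrow> 'a::ab_group_add \<Rightarrow> 'a"
  assumes "vector_space scale"
  shows "(\<Sum>i\<le>n. scale (q_binom q n i) (T (Suc i) (n - i) + scale (q ^ i) (T i (Suc (n - i))))) =
    (\<Sum>i\<le>Suc n. scale (q_binom q (Suc n) i) (T i (Suc n - i)))"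
proof -
  interpret vector_space scale by fact
  \<comment> \<open>The extra term at i = n + 1 carries \<open>q_binom q n (Suc n) = 0\<close>; with
    it the index 0 can be split off and the rest reindexed.\<close>
  have "(\<Sum>i\<le>n. scale (q_binom q n i * q ^ i) (T i (Suc (n - i)))) =
      (\<Sum>i\<le>Suc n. scale (q_binom q n i * q ^ i) (T i (Suc n - i)))"
    by (auto simp: q_binom_eq_0 Suc_diff_le intro!: sum.cong)
  also have "\<dots> = T 0 (Suc n) + (\<Sum>i\<le>n. scale (q_binom q n (Suc i) * q ^ Suc i) (T (Suc i) (n - i)))"
    by (subst sum.atMost_Suc_shift) simp
  finally show ?thesis
    by (subst sum.atMost_Suc_shift)
      (simp add: scale_right_distrib scale_left_distrib sum.distrib mult.commute)
qed

text \<open>Both double sums run once over the triples i + j + k = N, with the third or the second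
  entry fixed by the outer sum. These are the two bracketings of a triple product below.\<close>

lemma sum_triangle_swap:
  fixes f :: "nat \<Rightarrow> nat \<Rightarrow> nat \<Rightarrow> 'a::comm_monoid_add"
  shows "(\<Sum>m\<le>N. \<Sum>i\<le>m. f i (m - i) (N - m)) = (\<Sum>m\<le>N. \<Sum>i\<le>m. f i (N - m) (m - i))"
proof -
  have *: "(\<Sum>m\<le>N. \<Sum>i\<le>m. h i (m - i) (N - m)) = (\<Sum>i\<le>N. \<Sum>j\<le>N - i. h i j (N - i - j))"
    for h :: "nat \<Rightarrow> nat \<Rightarrow> nat \<Rightarrow> 'a"
    using fps_mult_assoc_lemma[of h N N] by (simp add: atLeast0AtMost)
  have "(\<Sum>j\<le>M. f i j (M - j)) = (\<Sum>j\<le>M. f i (M - j) j)" for i M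
    by (rule sum.reindex_bij_witness[where i = "\<lambda>j. M - j" and j = "\<lambda>j. M - j"]) auto
  thus ?thesis
    unfolding *[of f] *[of "\<lambda>i j k. f i k j"] by (simp only:)
qed

text \<open>What associativity of the q-exponential product rests on, freed from crossed products.
  \<open>D\<close> twists the right factor and \<open>E\<close> the left one by the same
  \<open>S\<close>, and both q-commute with \<open>S\<close> for the same q, so the two iterated
  Leibniz rules share their coefficients.\<close>

locale skew_derivation_pair = embedded_algebra sc A
  for sc :: "complex \<Rightarrow> 'a::ab_group_add \<Rightarrow> 'a" and A :: "(complex, 'a, 'm) module_scheme" (structure) +
  fixes D E S :: "'a \<Rightarrow> 'a" and q :: complex and l :: nat
  assumes D: "Vector_Spaces.linear sc sc D" and E: "Vector_Spaces.linear sc sc E"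
    and S: "Vector_Spaces.linear sc sc S"
    and D_closed: "a \<in> carrier A \<Longrightarrow> D a \<in> carrier A"
    and E_closed: "a \<in> carrier A \<Longrightarrow> E a \<in> carrier A"
    and S_closed: "a \<in> carrier A \<Longrightarrow> S a \<in> carrier A"
    and D_mult: "a \<in> carrier A \<Longrightarrow> b \<in> carrier A \<Longrightarrow> D (a \<otimes> b) = D a \<otimes> S b + a \<otimes> D b"
    and E_mult: "a \<in> carrier A \<Longrightarrow> b \<in> carrier A \<Longrightarrow> E (a \<otimes> b) = E a \<otimes> b + S a \<otimes> E b"
    and D_S: "a \<in> carrier A \<Longrightarrow> D (S a) = sc q (S (D a))"
    and E_S: "a \<in> carrier A \<Longrightarrow> E (S a) = sc q (S (E a))"
    and D_E: "a \<in> carrier A \<Longrightarrow> D (E a) = E (D a)"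
    and D_nilpotent: "a \<in> carrier A \<Longrightarrow> (D ^^ l) a = 0"
    and E_nilpotent: "a \<in> carrier A \<Longrightarrow> (E ^^ l) a = 0"
    and l: "l \<ge> 2" and q: "primitive_root_of_unity l q"
begin

sublocale D: Vector_Spaces.linear sc sc D by (rule D)
sublocale E: Vector_Spaces.linear sc sc E by (rule E)
sublocale S: Vector_Spaces.linear sc sc S by (rule S)

lemma funpow_closed:
  assumes "a \<in> carrier A"
  shows "(D ^^ n) a \<in> carrier A" "(E ^^ n) a \<in> carrier A" "(S ^^ n) a \<in> carrier A"
  by (induction n) (auto simp: assms D_closed E_closed S_closed)

lemma E_funpow_scale: "(E ^^ n) (sc c a) = sc c ((E ^^ n) a)"
  by (induction n) (simp_all add: E.scale)

lemma D_funpow_scale: "(D ^^ n) (sc c a) = sc c ((D ^^ n) a)"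
  by (induction n) (simp_all add: D.scale)

lemma D_funpow_linear: "Vector_Spaces.linear sc sc (D ^^ n)"
  by (induction n) (auto simp: Vector_Spaces.linear_iff vector_space_axioms D.add D.scale)

lemma E_funpow_linear: "Vector_Spaces.linear sc sc (E ^^ n)"
  by (induction n) (auto simp: Vector_Spaces.linear_iff vector_space_axioms E.add E.scale)

lemma D_S_funpow: "a \<in> carrier A \<Longrightarrow> D ((S ^^ n) a) = sc (q ^ n) ((S ^^ n) (D a))"
  by (induction n) (simp_all add: D_S funpow_closed S.scale)

lemma E_S_funpow: "a \<in> carrier A \<Longrightarrow> E ((S ^^ n) a) = sc (q ^ n) ((S ^^ n) (E a))"
  by (induction n) (simp_all add: E_S funpow_closed S.scale)

lemma D_E_funpow: "a \<in> carrier A \<Longrightarrow> (D ^^ m) ((E ^^ n) a) = (E ^^ n) ((D ^^ m) a)"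
proof -
  have "D ((E ^^ n) a) = (E ^^ n) (D a)" if "a \<in> carrier A" for a
    using that by (induction n) (simp_all add: D_E funpow_closed)
  thus "a \<in> carrier A \<Longrightarrow> (D ^^ m) ((E ^^ n) a) = (E ^^ n) ((D ^^ m) a)"
    by (induction m) (simp_all add: funpow_closed)
qed

lemma nilpotent:
  assumes "l \<le> n" "a \<in> carrier A"
  shows "(D ^^ n) a = 0" "(E ^^ n) a = 0"
  using D_nilpotent[OF funpow_closed(1)[OF assms(2), of "n - l"]]
    E_nilpotent[OF funpow_closed(2)[OF assms(2), of "n - l"]] assms(1)
    funpow_add[of l "n - l" D] funpow_add[of l "n - l" E] by simp_all

text \<open>On tensors, \<open>D\<close> of a product is X + Y with X = D \<otimes> S and Y = 1
  \<otimes> D, and \<open>D_S\<close> says Y X = q X Y. The formula is the q-binomial theorem for (X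
  + Y)^n.\<close>

lemma D_funpow_mult:
  assumes "a \<in> carrier A" "b \<in> carrier A"
  shows "(D ^^ n) (a \<otimes> b) =
    (\<Sum>i\<le>n. sc (q_binom q n i) ((D ^^ i) a \<otimes> (S ^^ i) ((D ^^ (n - i)) b)))"
proof (induction n)
  case (Suc n)
  have "D ((D ^^ i) a \<otimes> (S ^^ i) ((D ^^ j) b)) =
      (D ^^ Suc i) a \<otimes> (S ^^ Suc i) ((D ^^ j) b) + sc (q ^ i) ((D ^^ i) a \<otimes> (S ^^ i) ((D ^^ Suc j) b))"
    for i j
    using assms by (simp add: D_mult funpow_closed D_S_funpow mult_scale)
  with Suc show ?case
    using q_leibniz_step[OF vector_space_axioms, of q n "\<lambda>i j. (D ^^ i) a \<otimes> (S ^^ i) ((D ^^ j) b)"]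
    by (simp only: funpow.simps o_def D.sum D.scale)
qed simp

text \<open>The mirror image: X = S \<otimes> E and Y = E \<otimes> 1, with Y X = q X Y by
  \<open>E_S\<close>.\<close>

lemma E_funpow_mult:
  assumes "a \<in> carrier A" "b \<in> carrier A"
  shows "(E ^^ n) (a \<otimes> b) =
    (\<Sum>i\<le>n. sc (q_binom q n i) ((S ^^ i) ((E ^^ (n - i)) a) \<otimes> (E ^^ i) b))"
proof (induction n)
  case (Suc n)
  have "E ((S ^^ i) ((E ^^ j) a) \<otimes> (E ^^ i) b) =
      (S ^^ Suc i) ((E ^^ j) a) \<otimes> (E ^^ Suc i) b + sc (q ^ i) ((S ^^ i) ((E ^^ Suc j) a) \<otimes> (E ^^ i) b)"
    for i j
    using assms by (simp add: E_mult funpow_closed E_S_funpow scale_mult add.commute)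
  with Suc show ?case
    using q_leibniz_step[OF vector_space_axioms, of q n "\<lambda>i j. (S ^^ i) ((E ^^ j) a) \<otimes> (E ^^ i) b"]
    by (simp only: funpow.simps o_def E.sum E.scale)
qed simp

text \<open>
  For \<open>n \<ge> l\<close> this is \<open>1 / 0 = 0\<close>, which is why the truncation in \<^const>\<open>q_exp_product\<close> can be
  dropped.
\<close>

definition w :: "nat \<Rightarrow> complex"
  where "w n = 1 / q_fact q n"

lemma q_exp_product_eq: "q_exp_product A l q D E n a b = sc (w n) ((D ^^ n) a \<otimes> (E ^^ n) b)"
  using q_fact_zero[OF q l, of n] by (auto simp: q_exp_product_def w_def smult_eq zero_eq)

lemma w_binom: "n < l \<Longrightarrow> i \<le> n \<Longrightarrow> w n * q_binom q n i = w i * w (n - i)"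
  using q_binom_eq[OF q l] by (simp add: w_def)

text \<open>Below l this is the factorial formula for Gaussian binomials. From l on
  \<open>w n\<close> is 0 while \<open>w i * w (n - i)\<close> need not be; the right side vanishes
  since E^n c = 0.\<close>

lemma D_funpow_mult_left:
  assumes "a \<in> carrier A" "b \<in> carrier A" "c \<in> carrier A"
  shows "sc (w n) ((D ^^ n) (a \<otimes> b) \<otimes> (E ^^ n) c) =
    (\<Sum>i\<le>n. sc (w i * w (n - i)) ((D ^^ i) a \<otimes> (S ^^ i) ((D ^^ (n - i)) b) \<otimes> (E ^^ n) c))"
proof (cases "n < l")
  case True
  thus ?thesis
    using assms by (auto simp: D_funpow_mult sum_mult scale_sum_right scale_mult w_binom intro!: sum.cong)
next
  case False
  thus ?thesis
    using assms by (simp add: nilpotent mult_zero)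
qed

text \<open>Here the case n \<ge> l rests on D^n a = 0.\<close>

lemma E_funpow_mult_right:
  assumes "a \<in> carrier A" "b \<in> carrier A" "c \<in> carrier A"
  shows "sc (w n) ((D ^^ n) a \<otimes> (E ^^ n) (b \<otimes> c)) =
    (\<Sum>i\<le>n. sc (w i * w (n - i)) ((D ^^ n) a \<otimes> ((S ^^ i) ((E ^^ (n - i)) b) \<otimes> (E ^^ i) c)))"
proof (cases "n < l")
  case True
  thus ?thesis
    using assms by (auto simp: E_funpow_mult mult_sum scale_sum_right mult_scale w_binom intro!: sum.cong)
next
  case False
  thus ?thesis
    using assms by (simp add: nilpotent zero_mult)
qed

lemma q_exp_product_assoc:
  assumes a: "a \<in> carrier A" and b: "b \<in> carrier A" and c: "c \<in> carrier A"
  defines "\<mu> \<equiv> q_exp_product A l q D E"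
  shows "(\<Sum>n\<le>N. \<mu> (N - n) (\<mu> n a b) c) = (\<Sum>n\<le>N. \<mu> (N - n) a (\<mu> n b c))"
proof -
  \<comment> \<open>The pairs (a, c), (b, c) and (a, b) are contracted i, j and n times, each
    contraction putting a \<open>D\<close> on its left and an \<open>E\<close> on its right entry.
    S^i on b comes from the i contractions that pass across b.\<close>
  define H where "H i j n = sc (w i * w j * w n)
    ((D ^^ (i + n)) a \<otimes> (S ^^ i) ((D ^^ j) ((E ^^ n) b)) \<otimes> (E ^^ (i + j)) c)" for i j n
  have left: "\<mu> m (\<mu> n a b) c = (\<Sum>i\<le>m. H i (m - i) n)" for m n
  proof -
    have "\<mu> m (\<mu> n a b) c = sc (w n) (sc (w m) ((D ^^ m) ((D ^^ n) a \<otimes> (E ^^ n) b) \<otimes> (E ^^ m) c))"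
      by (simp add: \<mu>_def q_exp_product_eq D_funpow_scale scale_mult mult.commute)
    also have "\<dots> = (\<Sum>i\<le>m. H i (m - i) n)"
      using a b c by (subst D_funpow_mult_left)
        (auto simp: funpow_closed H_def scale_sum_right funpow_add mult_ac intro!: sum.cong)
    finally show ?thesis .
  qed
  \<comment> \<open>This bracketing applies \<open>D\<close> to b before \<open>E\<close>, the other
    one after it; commutation of the two reconciles them.\<close>
  have right: "\<mu> m a (\<mu> n b c) = (\<Sum>i\<le>m. H i n (m - i))" for m n
  proof -
    have "\<mu> m a (\<mu> n b c) = sc (w n) (sc (w m) ((D ^^ m) a \<otimes> (E ^^ m) ((D ^^ n) b \<otimes> (E ^^ n) c)))"
      by (simp add: \<mu>_def q_exp_product_eq E_funpow_scale mult_scale mult.commute)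
    also have "\<dots> = (\<Sum>i\<le>m. H i n (m - i))"
      using a b c by (subst E_funpow_mult_right)
        (auto simp: funpow_closed H_def scale_sum_right funpow_add mult_ac D_E_funpow
          mult_assoc intro!: sum.cong)
    finally show ?thesis .
  qed
  have rev: "(\<Sum>n\<le>N. f (N - n) n) = (\<Sum>n\<le>N. f n (N - n))" for f :: "nat \<Rightarrow> nat \<Rightarrow> 'a"
    by (rule sum.reindex_bij_witness[where i = "\<lambda>j. N - j" and j = "\<lambda>j. N - j"]) auto
  show ?thesis
    unfolding rev[of "\<lambda>m n. \<mu> m (\<mu> n a b) c"] rev[of "\<lambda>m n. \<mu> m a (\<mu> n b c)"]
    unfolding left right
    by (rule sum_triangle_swap)
qed

lemma bilinear_q_exp_product: "bilinear_op A (q_exp_product A l q D E n)"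
proof -
  interpret Dn: Vector_Spaces.linear sc sc "D ^^ n" by (rule D_funpow_linear)
  interpret En: Vector_Spaces.linear sc sc "E ^^ n" by (rule E_funpow_linear)
  show ?thesis
    unfolding bilinear_op_def q_exp_product_eq
    by (auto intro!: linear_endoI carrier_scale mult_closed funpow_closed
        simp: Vector_Spaces.linear_iff vector_space_axioms Dn.add Dn.scale En.add En.scale
          add_mult mult_add scale_mult mult_scale scale_right_distrib mult.commute)
qed

theorem formal_deformation_q_exp_product: "formal_deformation A (q_exp_product A l q D E)"
  by (rule formal_deformationI)
    (simp_all add: q_exp_product_assoc bilinear_q_exp_product, simp add: q_exp_product_eq w_def)

text \<open>Since l \<ge> 2, the exponent 1 escapes the truncation, and its weight 1 / (1)_q! is
  1.\<close>

lemma q_exp_product_1: "q_exp_product A l q D E 1 a b = D a \<otimes> E b"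
  by (simp add: q_exp_product_eq w_def q_fact_Suc)

text \<open>Both sides of the cocycle identity expand to D(a) E(b) c + D(a) S(b) E(c) + a D(b)
  E(c).\<close>

lemma hochschild_two_cocycle_skew: "hochschild_two_cocycle A (\<lambda>a b. D a \<otimes> E b)"
proof -
  have "bilinear_op A (\<lambda>a b. D a \<otimes> E b)"
    using bilinear_q_exp_product[of 1] by (simp only: bilinear_op_def q_exp_product_1)
  thus ?thesis
    unfolding hochschild_two_cocycle_def
    by (auto simp: add_eq D_mult E_mult add_mult mult_add mult_assoc D_closed E_closed S_closed add.assoc)
qed

end

section \<open>Crossed products\<close>

lemma lookup_crossed_scale [simp]:
  "Poly_Mapping.lookup (crossed_scale c a) h = pscale c (Poly_Mapping.lookup a h)"
  by (simp add: crossed_scale_def Poly_Mapping.map.rep_eq when_def)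

lemma vector_space_crossed_scale: "vector_space (crossed_scale :: complex \<Rightarrow> ('g, 'n) crossed \<Rightarrow> _)"
  by unfold_locales
    (auto intro!: poly_mapping_eqI simp: lookup_add sym.scale_right_distrib sym.scale_left_distrib)

interpretation crossed: vector_space "crossed_scale :: complex \<Rightarrow> ('g, 'n) crossed \<Rightarrow> _"
  by (rule vector_space_crossed_scale)

lemma crossed_scale_single [simp]:
  "crossed_scale c (Poly_Mapping.single h r) = Poly_Mapping.single h (pscale c r)"
  by (rule poly_mapping_eqI) (simp add: lookup_single when_def)

lemma keys_crossed_scale: "c \<noteq> 0 \<Longrightarrow> Poly_Mapping.keys (crossed_scale c a) = Poly_Mapping.keys a"
  by (auto simp: in_keys_iff)

lemma keys_pscale: "c \<noteq> 0 \<Longrightarrow> Poly_Mapping.keys (pscale c p) = Poly_Mapping.keys p"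
  by (auto simp: in_keys_iff)

lemma linear_crossed_extend:
  "Vector_Spaces.linear crossed_scale crossed_scale (crossed_extend B)"
proof -
  let ?E = "\<lambda>h r. \<Sum>k\<in>Poly_Mapping.keys r. crossed_scale (Poly_Mapping.lookup r k) (B k h)"
  have add: "?E h (p + r) = ?E h p + ?E h r" for h p r
    by (rule setsum_keys_plus_distrib) (auto simp: crossed.scale_left_distrib)
  have "crossed_extend B (a + b) = crossed_extend B a + crossed_extend B b" for a b
    unfolding crossed_extend_def by (rule setsum_keys_plus_distrib) (auto simp: add)
  moreover have "crossed_extend B (crossed_scale c a) = crossed_scale c (crossed_extend B a)" for c a
  proof (cases "c = 0")
    case False
    thus ?thesis
      by (simp add: crossed_extend_def keys_crossed_scale keys_pscale crossed.scale_sum_right)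
  qed (simp add: crossed_extend_def)
  ultimately show ?thesis
    by unfold_locales auto
qed

text \<open>Passes from the basis elements x^k h to all r h, on which the later identities are
  checked; \<open>T\<close> is the underlying map of S(V).\<close>

lemma crossed_extend_single:
  assumes "Vector_Spaces.linear pscale pscale T"
    and "\<And>k. B k h = Poly_Mapping.single h' (T (mono_poly k))"
  shows "crossed_extend B (Poly_Mapping.single h r) = Poly_Mapping.single h' (T r)"
proof -
  interpret Vector_Spaces.linear pscale pscale T by fact
  have sum_single: "(\<Sum>k\<in>K. Poly_Mapping.single h' (F k)) = Poly_Mapping.single h' (sum F K)" for F K
    by (induction K rule: infinite_finite_induct) (simp_all add: single_add)
  have "T r = (\<Sum>k\<in>Poly_Mapping.keys r. pscale (Poly_Mapping.lookup r k) (T (mono_poly k)))"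
    by (subst (1) sym_alg_expand) (simp add: sum scale)
  thus ?thesis
    by (simp add: crossed_extend_def assms(2) sum_single)
qed

lemma crossed_induct [consumes 1, case_names zero single add]:
  assumes "Poly_Mapping.keys a \<subseteq> H"
    and zero: "P 0"
    and single: "\<And>h r. h \<in> H \<Longrightarrow> P (Poly_Mapping.single h r)"
    and add: "\<And>a b. Poly_Mapping.keys a \<subseteq> H \<Longrightarrow> Poly_Mapping.keys b \<subseteq> H \<Longrightarrow> P a \<Longrightarrow> P b \<Longrightarrow> P (a + b)"
  shows "P (a :: ('g, 'n) crossed)"
proof -
  have "Poly_Mapping.keys (\<Sum>h\<in>K. Poly_Mapping.single h (F h)) \<subseteq> H \<and>
      P (\<Sum>h\<in>K. Poly_Mapping.single h (F h))" if "finite K" "K \<subseteq> H" for K F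
    using that
  proof induction
    case (insert h K)
    have "Poly_Mapping.keys (Poly_Mapping.single h (F h)) \<subseteq> H"
      using insert by auto
    with insert keys_add[of "Poly_Mapping.single h (F h)" "\<Sum>h\<in>K. Poly_Mapping.single h (F h)"] show ?case
      by (auto intro!: add single)
  qed (use zero in auto)
  moreover have "a = (\<Sum>h\<in>Poly_Mapping.keys a. Poly_Mapping.single h (Poly_Mapping.lookup a h))"
    by (rule poly_mapping_eqI) (auto simp: lookup_sum lookup_single when_def in_keys_iff)
  ultimately show ?thesis
    using assms(1) by (metis finite_keys)
qed

locale crossed_algebra = linear_group_action scale x G \<phi>
  for scale :: "complex \<Rightarrow> 'v::ab_group_add \<Rightarrow> 'v" and x :: "'n::finite \<Rightarrow> 'v"
    and G :: "('g, 'm) monoid_scheme" (structure) and \<phi> +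
  fixes \<alpha> :: "'g \<Rightarrow> 'g \<Rightarrow> complex"
  assumes cocycle: "normalized_two_cocycle G \<alpha>"
begin

definition A :: "(complex, ('g, 'n) crossed) module"
  where "A = crossed_product G \<alpha> act"

sublocale act: Vector_Spaces.linear pscale pscale "act h" for h
  by (rule linear_act)

lemma
  assumes "h \<in> carrier G" "k \<in> carrier G"
  shows cocycle_nonzero: "\<alpha> h k \<noteq> 0"
    and cocycle_assoc: "j \<in> carrier G \<Longrightarrow> \<alpha> h k * \<alpha> (h \<otimes> k) j = \<alpha> h (k \<otimes> j) * \<alpha> k j"
    and cocycle_one: "\<alpha> \<one> h = 1" "\<alpha> h \<one> = 1"
  using assms cocycle by (auto simp: normalized_two_cocycle_def)

lemma carrier_A: "carrier A = {a. Poly_Mapping.keys a \<subseteq> carrier G}"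
  by (simp add: A_def crossed_product_def)

lemma mult_A: "a \<otimes>\<^bsub>A\<^esub> b = (\<Sum>g\<in>Poly_Mapping.keys a. \<Sum>h\<in>Poly_Mapping.keys b.
    Poly_Mapping.single (g \<otimes> h)
      (pscale (\<alpha> g h) (Poly_Mapping.lookup a g * act g (Poly_Mapping.lookup b h))))"
  by (simp add: A_def crossed_product_def)

lemma mult_single_A: "Poly_Mapping.single h r \<otimes>\<^bsub>A\<^esub> Poly_Mapping.single k r' =
    Poly_Mapping.single (h \<otimes> k) (pscale (\<alpha> h k) (r * act h r'))"
  by (simp add: mult_A act.zero)

lemma add_mult_A: "(a + b) \<otimes>\<^bsub>A\<^esub> c = a \<otimes>\<^bsub>A\<^esub> c + b \<otimes>\<^bsub>A\<^esub> c"
  unfolding mult_A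
  by (rule setsum_keys_plus_distrib)
    (simp_all add: distrib_right sym.scale_right_distrib single_add sum.distrib)

lemma mult_add_A: "a \<otimes>\<^bsub>A\<^esub> (b + c) = a \<otimes>\<^bsub>A\<^esub> b + a \<otimes>\<^bsub>A\<^esub> c"
  unfolding mult_A sum.distrib[symmetric]
  by (intro sum.cong refl setsum_keys_plus_distrib)
    (simp_all add: distrib_left sym.scale_right_distrib single_add act.zero act.add)

lemma scale_mult_A: "crossed_scale z a \<otimes>\<^bsub>A\<^esub> b = crossed_scale z (a \<otimes>\<^bsub>A\<^esub> b)"
  by (cases "z = 0") (simp_all add: mult_A keys_crossed_scale crossed.scale_sum_right mult.commute)

lemma mult_scale_A: "a \<otimes>\<^bsub>A\<^esub> crossed_scale z b = crossed_scale z (a \<otimes>\<^bsub>A\<^esub> b)"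
  by (cases "z = 0")
    (simp_all add: mult_A keys_crossed_scale crossed.scale_sum_right act.scale mult.commute)

lemma zero_mult_A [simp]: "0 \<otimes>\<^bsub>A\<^esub> b = 0" "a \<otimes>\<^bsub>A\<^esub> 0 = 0"
  by (simp_all add: mult_A)

lemma single_carrier: "h \<in> carrier G \<Longrightarrow> Poly_Mapping.single h r \<in> carrier A"
  by (simp add: carrier_A)

lemma add_carrier: "a \<in> carrier A \<Longrightarrow> b \<in> carrier A \<Longrightarrow> a + b \<in> carrier A"
  using keys_add[of a b] by (auto simp: carrier_A)

lemma zero_carrier: "0 \<in> carrier A"
  by (simp add: carrier_A)

lemma carrier_induct [consumes 1, case_names zero single add]:
  assumes "a \<in> carrier A" and "P 0"
    and "\<And>h r. h \<in> carrier G \<Longrightarrow> P (Poly_Mapping.single h r)"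
    and "\<And>a b. a \<in> carrier A \<Longrightarrow> b \<in> carrier A \<Longrightarrow> P a \<Longrightarrow> P b \<Longrightarrow> P (a + b)"
  shows "P a"
  using assms(1) unfolding carrier_A mem_Collect_eq
  by (induction a rule: crossed_induct) (use assms(2-) in \<open>auto simp: carrier_A\<close>)

lemma carrier_induct2 [consumes 2, case_names zero_left zero_right single add_left add_right]:
  assumes a: "a \<in> carrier A" and b: "b \<in> carrier A"
    and "\<And>b. P 0 b" "\<And>a. P a 0"
    and "\<And>h r k r'. h \<in> carrier G \<Longrightarrow> k \<in> carrier G \<Longrightarrow>
      P (Poly_Mapping.single h r) (Poly_Mapping.single k r')"
    and "\<And>a a' b. a \<in> carrier A \<Longrightarrow> a' \<in> carrier A \<Longrightarrow> P a b \<Longrightarrow> P a' b \<Longrightarrow> P (a + a') b"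
    and "\<And>a b b'. b \<in> carrier A \<Longrightarrow> b' \<in> carrier A \<Longrightarrow> P a b \<Longrightarrow> P a b' \<Longrightarrow> P a (b + b')"
  shows "P a b"
  using a
proof (induction a rule: carrier_induct)
  case (single h r)
  show ?case
    using b by (induction b rule: carrier_induct) (use assms(3-) single in auto)
qed (use assms(3-) in auto)

lemma mult_closed_A:
  assumes "a \<in> carrier A" "b \<in> carrier A"
  shows "a \<otimes>\<^bsub>A\<^esub> b \<in> carrier A"
  using assms
  by (induction a b rule: carrier_induct2)
    (simp_all add: mult_single_A add_mult_A mult_add_A add_carrier zero_carrier single_carrier)

lemma mult_assoc_A:
  assumes "a \<in> carrier A" "b \<in> carrier A" "c \<in> carrier A"
  shows "(a \<otimes>\<^bsub>A\<^esub> b) \<otimes>\<^bsub>A\<^esub> c = a \<otimes>\<^bsub>A\<^esub> (b \<otimes>\<^bsub>A\<^esub> c)"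
  using assms(1,2)
proof (induction a b rule: carrier_induct2)
  case (single h r k r')
  show ?case
    using assms(3)
  proof (induction c rule: carrier_induct)
    case (single j r'')
    thus ?case
      using \<open>h \<in> carrier G\<close> \<open>k \<in> carrier G\<close> cocycle_assoc[of h k j]
      by (simp add: mult_single_A m_assoc act_act act_mult act.scale mult_ac)
  qed (simp_all add: mult_add_A)
qed (simp_all add: add_mult_A mult_add_A)

sublocale A: embedded_algebra crossed_scale A
proof unfold_locales
  show "crossed.subspace (carrier A)"
  proof (rule crossed.subspaceI)
    show "crossed_scale c a \<in> carrier A" if "a \<in> carrier A" for c a
      using that by (auto simp: carrier_A in_keys_iff)
  qed (auto simp: add_carrier zero_carrier)
qed (simp_all add: add_mult_A mult_add_A scale_mult_A mult_scale_A mult_closed_A mult_assoc_A,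
    simp_all add: A_def crossed_product_def)

text \<open>A factor supported at the identity moves no group component, so commutators with it can
  be computed one component at a time.\<close>

lemma lookup_mult_one_left:
  assumes "b \<in> carrier A"
  shows "Poly_Mapping.lookup (Poly_Mapping.single \<one> r \<otimes>\<^bsub>A\<^esub> b) h = r * Poly_Mapping.lookup b h"
  using assms
  by (induction b rule: carrier_induct)
    (auto simp: mult_add_A mult_single_A lookup_add distrib_left cocycle_one act_id lookup_single when_def)

lemma lookup_mult_one_right:
  assumes "b \<in> carrier A"
  shows "Poly_Mapping.lookup (b \<otimes>\<^bsub>A\<^esub> Poly_Mapping.single \<one> r) h = Poly_Mapping.lookup b h * act h r"
  using assms
  by (induction b rule: carrier_induct)
    (auto simp: add_mult_A mult_single_A lookup_add distrib_right cocycle_one lookup_single when_def)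

end

section \<open>The skew derivations of the crossed product\<close>

locale quantum_crossed_algebra = crossed_algebra scale x G \<phi> \<alpha>
  for scale :: "complex \<Rightarrow> 'v::ab_group_add \<Rightarrow> 'v" and x :: "'n::finite \<Rightarrow> 'v"
    and G :: "('g, 'm) monoid_scheme" (structure) and \<phi> and \<alpha> +
  fixes i1 i2 :: 'n and q :: complex and l :: nat and g :: 'g and s :: "'n sym_alg"
    and \<chi>1 \<chi>2 :: "'g \<Rightarrow> complex"
  assumes l: "l \<ge> 2" and q: "primitive_root_of_unity l q"
    and g: "g \<in> carrier G" and central: "h \<in> carrier G \<Longrightarrow> g \<otimes> h = h \<otimes> g"
    and i1_i2: "i1 \<noteq> i2"
    and g_x1: "\<phi> g (x i1) = scale q (x i1)"
    and g_x2: "\<phi> g (x i2) = scale (inverse q) (x i2)"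
    and g_x: "i \<noteq> i1 \<Longrightarrow> i \<noteq> i2 \<Longrightarrow> \<phi> g (x i) = x i"
    and line1: "h \<in> carrier G \<Longrightarrow> \<phi> h ` span {x i1} \<subseteq> span {x i1}"
    and line2: "h \<in> carrier G \<Longrightarrow> \<phi> h ` span {x i2} \<subseteq> span {x i2}"
    and \<chi>1_def: "\<chi>1 = character_on scale \<phi> (x i1)"
    and \<chi>2_def: "\<chi>2 = character_on scale \<phi> (x i2)"
    and s_nonzero: "s \<noteq> 0" and s_free: "free_of i1 s" "free_of i2 s"
    and act_s: "h \<in> carrier G \<Longrightarrow>
      act h s = pscale (\<chi>1 h * \<chi>2 h * \<alpha> g h * inverse (\<alpha> h g)) s"
begin

section \<open>Characters and the shape of the action of G on V\<close>

lemma q_facts: "q \<noteq> 0" "q \<noteq> 1" "inverse q \<noteq> 1"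
proof -
  show "q \<noteq> 0" using q by (auto simp: primitive_root_of_unity_def zero_power)
  show "q \<noteq> 1" using q_num_root_of_unity(1)[OF q l] .
  thus "inverse q \<noteq> 1" by (simp add: inverse_eq_1_iff)
qed

lemma scale_x_eq_iff: "scale c (x i) = scale d (x i) \<longleftrightarrow> c = d"
proof
  assume "scale c (x i) = scale d (x i)"
  hence "coord (scale c (x i)) i = coord (scale d (x i)) i" by (rule arg_cong)
  thus "c = d" by (simp add: coord_scale coord_basis)
qed simp

lemma character_onI: "\<phi> h (x i) = scale c (x i) \<Longrightarrow> character_on scale \<phi> (x i) h = c"
  unfolding character_on_def by (rule the_equality) (simp, metis scale_x_eq_iff)

lemma character_on_eigen:
  assumes "\<phi> h ` span {x i} \<subseteq> span {x i}"
  shows "\<phi> h (x i) = scale (character_on scale \<phi> (x i) h) (x i)"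
proof -
  have "\<phi> h (x i) \<in> span {x i}"
    using assms span_base[of "x i" "{x i}"] by auto
  then obtain c where "\<phi> h (x i) = scale c (x i)"
    by (auto simp: span_singleton)
  with character_onI show ?thesis by metis
qed

lemma \<chi>1: "h \<in> carrier G \<Longrightarrow> \<phi> h (x i1) = scale (\<chi>1 h) (x i1)"
  and \<chi>2: "h \<in> carrier G \<Longrightarrow> \<phi> h (x i2) = scale (\<chi>2 h) (x i2)"
  using character_on_eigen line1 line2 by (simp_all add: \<chi>1_def \<chi>2_def)

lemma \<chi>1_g: "\<chi>1 g = q"
  using g_x1 by (simp add: \<chi>1_def character_onI)

lemma \<chi>1_mult: "h \<in> carrier G \<Longrightarrow> k \<in> carrier G \<Longrightarrow> \<chi>1 (h \<otimes> k) = \<chi>1 h * \<chi>1 k"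
proof -
  assume h: "h \<in> carrier G" and k: "k \<in> carrier G"
  interpret h: Vector_Spaces.linear scale scale "\<phi> h" using h by (rule linear_action)
  have "\<phi> (h \<otimes> k) (x i1) = scale (\<chi>1 h * \<chi>1 k) (x i1)"
    using composition_rule[of "x i1" h k] h k \<chi>1[of k] \<chi>1[of h] by (simp add: h.scale mult.commute)
  thus ?thesis by (simp add: \<chi>1_def character_onI)
qed

lemma \<chi>1_one: "\<chi>1 \<one> = 1"
proof -
  have "\<phi> \<one> (x i1) = scale 1 (x i1)"
    using id_eq_one by (metis UNIV_I restrict_apply' scale_one)
  thus ?thesis by (simp add: \<chi>1_def character_onI)
qed

lemma \<chi>1_inv: "h \<in> carrier G \<Longrightarrow> \<chi>1 h \<noteq> 0 \<and> \<chi>1 (inv h) = inverse (\<chi>1 h)"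
  using \<chi>1_mult[of "inv h" h] \<chi>1_one inverse_unique[of "\<chi>1 h" "\<chi>1 (inv h)"]
  by (auto simp: mult.commute)

lemma cancel:
  "h \<in> carrier G \<Longrightarrow> \<chi>1 h * (inverse (\<chi>1 h) * z) = z"
  "q * (inverse q * z) = z" "inverse q * (q * z) = z"
  using \<chi>1_inv[of h] q_facts(1) by simp_all

lemma coord_g: "coord (\<phi> g v) i = (if i = i1 then q else if i = i2 then inverse q else 1) * coord v i"
proof -
  define c where "c i = (if i = i1 then q else if i = i2 then inverse q else 1)" for i
  interpret \<phi>g: Vector_Spaces.linear scale scale "\<phi> g" using g by (rule linear_action)
  have x: "\<phi> g (x j) = scale (c j) (x j)" for j
    using g_x1 g_x2 g_x i1_i2 by (simp add: c_def)
  have sum: "coord (\<Sum>j\<in>J. f j) i = (\<Sum>j\<in>J. coord (f j) i)" if "finite J" for J and f :: "'n \<Rightarrow> 'v"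
    using that coord_scale[of 0 0 i] by induction (auto simp: coord_add)
  have "\<phi> g v = (\<Sum>j\<in>UNIV. scale (coord v j * c j) (x j))"
    by (subst coord_expand[of v]) (simp only: \<phi>g.sum \<phi>g.scale x scale_scale)
  hence "coord (\<phi> g v) i = (\<Sum>j\<in>UNIV. if j = i then coord v j * c j else 0)"
    by (simp only: sum[OF finite] coord_scale coord_basis) (intro sum.cong refl, simp)
  thus ?thesis by (simp add: c_def)
qed

text \<open>A variable x_j other than x_1, x_2 is fixed by g, hence so is h x_j, because h and g
  commute. On the coordinate i the element g acts by q or q^-1, neither of which is 1, so this
  coordinate is 0. If x_j is the other one of x_1, x_2, stability of its line suffices.\<close>

lemma coord_action_free:
  assumes h: "h \<in> carrier G" and i: "i = i1 \<or> i = i2" and "j \<noteq> i"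
  shows "coord (\<phi> h (x j)) i = 0"
proof (cases "j = i1 \<or> j = i2")
  case True
  thus ?thesis
    using \<chi>1[OF h] \<chi>2[OF h] \<open>j \<noteq> i\<close> by (auto simp: coord_scale coord_basis)
next
  case False
  have "\<phi> g (\<phi> h (x j)) = \<phi> h (x j)"
    using composition_rule[of "x j" g h] composition_rule[of "x j" h g] g h central[OF h] g_x[of j] False
    by simp
  with coord_g[of "\<phi> h (x j)" i] i q_facts i1_i2 show ?thesis
    by (auto split: if_splits)
qed

lemma act_var_eigen:
  assumes "h \<in> carrier G"
  shows "act h (mono_poly (Poly_Mapping.single i1 1)) = pscale (\<chi>1 h) (mono_poly (Poly_Mapping.single i1 1))"
    and "act h (mono_poly (Poly_Mapping.single i2 1)) = pscale (\<chi>2 h) (mono_poly (Poly_Mapping.single i2 1))"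
proof -
  interpret to_sym: Vector_Spaces.linear scale pscale to_sym by (rule linear_to_sym)
  show "act h (mono_poly (Poly_Mapping.single i1 1)) = pscale (\<chi>1 h) (mono_poly (Poly_Mapping.single i1 1))"
    "act h (mono_poly (Poly_Mapping.single i2 1)) = pscale (\<chi>2 h) (mono_poly (Poly_Mapping.single i2 1))"
    unfolding act_var \<chi>1[OF assms] \<chi>2[OF assms] to_sym.scale to_sym_basis by simp_all
qed

lemma act_var_free:
  assumes "h \<in> carrier G" "i = i1 \<or> i = i2" "j \<noteq> i"
  shows "free_of i (act h (mono_poly (Poly_Mapping.single j 1)))"
  unfolding act_var using assms by (intro free_of_to_sym coord_action_free)

lemma
  assumes h: "h \<in> carrier G"
  shows q_shift_act: "q_shift i1 p (act h r) = act h (q_shift i1 p r)"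
    and q_deriv1_act: "q_deriv i1 p (act h r) = pscale (\<chi>1 h) (act h (q_deriv i1 p r))"
    and q_deriv2_act: "q_deriv i2 p (act h r) = pscale (\<chi>2 h) (act h (q_deriv i2 p r))"
  using h
  by (intro q_shift_equivariant[OF linear_act act_one act_mult act_var_eigen(1)]
      q_deriv_equivariant[OF linear_act act_one act_mult act_var_eigen(1)]
      q_deriv_equivariant[OF linear_act act_one act_mult act_var_eigen(2)] act_var_free; simp)+

lemma act_g: "act g r = q_shift i2 (inverse q) (q_shift i1 q r)"
proof (induction r rule: sym_alg_induct)
  case (var j)
  interpret to_sym: Vector_Spaces.linear scale pscale to_sym by (rule linear_to_sym)
  have "\<phi> g (x j) = scale (if j = i1 then q else if j = i2 then inverse q else 1) (x j)"
    using g_x1 g_x2 g_x by auto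
  hence "act g (mono_poly (Poly_Mapping.single j 1)) =
      pscale (if j = i1 then q else if j = i2 then inverse q else 1) (mono_poly (Poly_Mapping.single j 1))"
    by (simp only: act_var to_sym.scale to_sym_basis)
  thus ?case
    using i1_i2 by (simp only: q_shift_var q_shift.scale sym.scale_scale) auto
qed (simp_all add: act.scale q_shift.scale act_one act.add q_shift.add act_mult q_shift_mult)

section \<open>Skew derivations of S(V) underlying D1 and D2\<close>

definition d1 :: "'n sym_alg \<Rightarrow> 'n sym_alg" where "d1 = q_deriv i1 q"
definition d2 :: "'n sym_alg \<Rightarrow> 'n sym_alg" where "d2 r = q_deriv i2 (inverse q) (q_shift i1 q r)"
definition \<sigma> :: "'n sym_alg \<Rightarrow> 'n sym_alg" where "\<sigma> = q_shift i1 q"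

sublocale d1: Vector_Spaces.linear pscale pscale d1
  unfolding d1_def by (rule linear_q_deriv)

sublocale d2: Vector_Spaces.linear pscale pscale d2
  unfolding d2_def[abs_def] by (rule linear_compose_sym[OF linear_q_deriv linear_q_shift])

sublocale \<sigma>: Vector_Spaces.linear pscale pscale \<sigma>
  unfolding \<sigma>_def by (rule linear_q_shift)

lemma d1_mult: "d1 (r * r') = d1 r * \<sigma> r' + r * d1 r'"
  by (simp add: d1_def \<sigma>_def q_deriv_mult)

text \<open>The q-derivative twists r' by x_2 -> q^-1 x_2 on top of the shift in x_1 already applied
  to it, and the composite is the action of g. On r only the shift in x_1 remains.\<close>

lemma d2_mult: "d2 (r * r') = d2 r * act g r' + \<sigma> r * d2 r'"
  by (simp add: d2_def \<sigma>_def q_shift_mult q_deriv_mult act_g)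

lemma d1_\<sigma>: "d1 (\<sigma> r) = pscale q (\<sigma> (d1 r))"
  by (simp add: d1_def \<sigma>_def q_deriv_q_shift_same)

lemma d2_\<sigma>: "d2 (\<sigma> r) = \<sigma> (d2 r)"
  using i1_i2 by (simp add: d2_def \<sigma>_def q_deriv_q_shift_commute)

text \<open>The factor q arises because \<open>d1\<close> has to cross the shift in x_1 contained in
  \<open>d2\<close>.\<close>

lemma d1_d2: "d1 (d2 r) = pscale q (d2 (d1 r))"
  using i1_i2 by (simp add: d1_def d2_def q_deriv_commute[of i1 i2] q_deriv_q_shift_same q_deriv.scale)

lemma act_d1: "h \<in> carrier G \<Longrightarrow> d1 (act h r) = pscale (\<chi>1 h) (act h (d1 r))"
  and act_d2: "h \<in> carrier G \<Longrightarrow> d2 (act h r) = pscale (\<chi>2 h) (act h (d2 r))"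
  and act_\<sigma>: "h \<in> carrier G \<Longrightarrow> \<sigma> (act h r) = act h (\<sigma> r)"
  by (simp_all add: d1_def d2_def \<sigma>_def q_deriv1_act q_deriv2_act q_shift_act)

text \<open>As s involves neither x_1 nor x_2, it is a constant for all three maps.\<close>

lemma d1_s: "d1 (s * r) = s * d1 r"
  and d2_s: "d2 (s * r) = s * d2 r"
  and \<sigma>_s: "\<sigma> (s * r) = s * \<sigma> r"
  using s_free unfolding mult.commute[of s]
  by (simp_all add: d1_def d2_def \<sigma>_def q_deriv_mult_free_of q_shift_mult q_shift_free_of)

lemma d2_s_power: "d2 (s ^ n * r) = s ^ n * d2 r"
  by (induction n) (simp_all add: d2_s mult.assoc)

lemma d1_nilpotent: "(d1 ^^ l) r = 0"
  unfolding d1_def using l q_num_root_of_unity(3)[OF q l] by (intro q_deriv_nilpotent) auto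

lemma d2_nilpotent: "(d2 ^^ l) r = 0"
proof -
  \<comment> \<open>\<open>d2\<close> is a composite of two commuting maps, so its l-th power
    contains the l-th power of the q-derivative.\<close>
  have comm: "(q_deriv i2 (inverse q) ^^ n) (q_shift i1 q r) = q_shift i1 q ((q_deriv i2 (inverse q) ^^ n) r)"
    for n r
    using i1_i2 by (induction n) (simp_all add: q_deriv_q_shift_commute)
  have "(d2 ^^ n) r = (q_deriv i2 (inverse q) ^^ n) ((q_shift i1 q ^^ n) r)" for n
    by (induction n) (simp_all add: d2_def comm)
  thus ?thesis
    using l q_num_root_of_unity(4)[OF q l] by (simp add: q_deriv_nilpotent)
qed

section \<open>The operators on A and their commutation rules\<close>

definition D1 :: "('g, 'n) crossed \<Rightarrow> ('g, 'n) crossed" where "D1 = D1_op G \<chi>1 q i1"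
definition D2 :: "('g, 'n) crossed \<Rightarrow> ('g, 'n) crossed" where "D2 = D2_op A q g s i1 i2"
definition \<Sigma> :: "('g, 'n) crossed \<Rightarrow> ('g, 'n) crossed"
  where "\<Sigma> = crossed_extend (\<lambda>k h.
    Poly_Mapping.single h (pscale (\<chi>1 (inv h)) (\<sigma> (mono_poly k))))"

lemma D1_single: "D1 (Poly_Mapping.single h r) = Poly_Mapping.single h (pscale (\<chi>1 (inv h)) (d1 r))"
  unfolding D1_def D1_op_def d1_def
  by (rule crossed_extend_single[where T = "\<lambda>r. pscale (\<chi>1 (inv h)) (q_deriv i1 q r)"])
    (intro linear_scale_sym linear_q_deriv, simp)

lemma \<Sigma>_single: "\<Sigma> (Poly_Mapping.single h r) = Poly_Mapping.single h (pscale (\<chi>1 (inv h)) (\<sigma> r))"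
  unfolding \<Sigma>_def
  by (rule crossed_extend_single[where T = "\<lambda>r. pscale (\<chi>1 (inv h)) (\<sigma> r)"])
    (intro linear_scale_sym \<sigma>.linear_axioms, simp)

lemma D2_single:
  "D2 (Poly_Mapping.single h r) = Poly_Mapping.single (g \<otimes> h) (pscale (\<alpha> g h) (d2 r * s))"
  unfolding D2_def D2_op_def
proof (rule crossed_extend_single[where T = "\<lambda>r. pscale (\<alpha> g h) (d2 r * s)"])
  show "Vector_Spaces.linear pscale pscale (\<lambda>r. pscale (\<alpha> g h) (d2 r * s))"
    by (intro linear_scale_sym linear_compose_sym[OF linear_mult_right_sym] d2.linear_axioms)
qed (simp add: mult_single_A act_one d2_def q_shift_mono q_deriv.scale)

lemma linear_D1: "Vector_Spaces.linear crossed_scale crossed_scale D1"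
  and linear_D2: "Vector_Spaces.linear crossed_scale crossed_scale D2"
  and linear_\<Sigma>: "Vector_Spaces.linear crossed_scale crossed_scale \<Sigma>"
  unfolding D1_def D1_op_def D2_def D2_op_def \<Sigma>_def by (rule linear_crossed_extend)+

sublocale D1: Vector_Spaces.linear crossed_scale crossed_scale D1 by (rule linear_D1)
sublocale D2: Vector_Spaces.linear crossed_scale crossed_scale D2 by (rule linear_D2)
sublocale \<Sigma>: Vector_Spaces.linear crossed_scale crossed_scale \<Sigma> by (rule linear_\<Sigma>)

text \<open>On r h and r' k, the derivative of h(r') brings a factor chi_1(h), which turns
  chi_1((hk)^-1) into the chi_1(k^-1) of D1(r' k).\<close>

lemma D1_mult:
  assumes "a \<in> carrier A" "b \<in> carrier A"
  shows "D1 (a \<otimes>\<^bsub>A\<^esub> b) = D1 a \<otimes>\<^bsub>A\<^esub> \<Sigma> b + a \<otimes>\<^bsub>A\<^esub> D1 b"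
  using assms
proof (induction a b rule: carrier_induct2)
  case (single h r k r')
  thus ?case
    by (simp add: mult_single_A D1_single \<Sigma>_single d1.scale d1_mult act_d1 act_\<sigma> act.scale \<chi>1_inv \<chi>1_mult
        inverse_mult_distrib cancel mult_ac sym.scale_right_distrib flip: single_add)
qed (simp_all add: D1.zero \<Sigma>.zero add_mult_A mult_add_A D1.add \<Sigma>.add add_ac)

text \<open>In the first term g passes r' and so produces the twist of \<open>d2_mult\<close>. In
  the second h passes s: the resulting chi_1(h) cancels the scalar of \<Sigma>, chi_2(h) is the
  eigenvalue from d2(h(r')), and the ratio of values of \<alpha> turns the order hg into gh.\<close>

lemma D2_mult:
  assumes "a \<in> carrier A" "b \<in> carrier A"
  shows "D2 (a \<otimes>\<^bsub>A\<^esub> b) = D2 a \<otimes>\<^bsub>A\<^esub> b + \<Sigma> a \<otimes>\<^bsub>A\<^esub> D2 b"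
  using assms
proof (induction a b rule: carrier_induct2)
  case (single h r k r')
  note hk = single
  have c1: "\<alpha> g h * \<alpha> (g \<otimes> h) k = \<alpha> g (h \<otimes> k) * \<alpha> h k"
    using g hk by (rule_tac cocycle_assoc)
  \<comment> \<open>The cocycle identity at (h, g, k), rewritten with hg = gh so that it shares the
    value at (gh, k) with \<open>c1\<close>.\<close>
  have "\<alpha> h g * \<alpha> (g \<otimes> h) k = \<alpha> h (g \<otimes> k) * \<alpha> g k"
    using cocycle_assoc[of h g k] g hk central[of h] by simp
  hence "\<alpha> h (g \<otimes> k) * \<alpha> g k * (\<alpha> g h * inverse (\<alpha> h g)) = \<alpha> g h * \<alpha> (g \<otimes> h) k"
    using cocycle_nonzero[of h g] g hk by (simp add: field_simps)
  with c1 have c2: "\<alpha> h (g \<otimes> k) * \<alpha> g k * (\<alpha> g h * inverse (\<alpha> h g)) = \<alpha> g (h \<otimes> k) * \<alpha> h k"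
    by simp
  have elt: "h \<otimes> (g \<otimes> k) = g \<otimes> (h \<otimes> k)" "g \<otimes> h \<otimes> k = g \<otimes> (h \<otimes> k)"
    using g hk central[of h] by (simp_all flip: m_assoc)
  have \<chi>1_cancel: "\<chi>1 h * (y * (inverse (\<chi>1 h) * z)) = y * z" for y z
    using \<chi>1_inv[OF hk(1)] by (simp add: field_simps)
  let ?S = "Poly_Mapping.single (g \<otimes> (h \<otimes> k)) :: 'n sym_alg \<Rightarrow> _"
  have "D2 (Poly_Mapping.single h r) \<otimes>\<^bsub>A\<^esub> Poly_Mapping.single k r' =
      ?S (pscale (\<alpha> g h * \<alpha> (g \<otimes> h) k) (d2 r * act g (act h r') * s))"
    using g hk by (simp add: D2_single mult_single_A elt act_act mult_ac)
  moreover have "\<Sigma> (Poly_Mapping.single h r) \<otimes>\<^bsub>A\<^esub> D2 (Poly_Mapping.single k r') =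
      ?S (pscale (\<alpha> h (g \<otimes> k) * \<alpha> g k * (\<alpha> g h * inverse (\<alpha> h g)) * \<chi>2 h * (\<chi>1 h * inverse (\<chi>1 h)))
        (\<sigma> r * act h (d2 r') * s))"
    using g hk by (simp add: D2_single \<Sigma>_single mult_single_A elt act_mult act_s act.scale \<chi>1_inv cancel \<chi>1_cancel mult_ac)
  moreover have "D2 (Poly_Mapping.single h r \<otimes>\<^bsub>A\<^esub> Poly_Mapping.single k r') =
      ?S (pscale (\<alpha> g (h \<otimes> k) * \<alpha> h k) (d2 r * act g (act h r') * s) +
        pscale (\<alpha> g (h \<otimes> k) * \<alpha> h k * \<chi>2 h) (\<sigma> r * act h (d2 r') * s))"
    using g hk by (simp add: D2_single mult_single_A d2.scale d2_mult act_d2 sym.scale_right_distrib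
        distrib_left distrib_right mult_ac)
  ultimately show ?case
    using \<chi>1_inv[OF hk(1)] by (simp only: c1 c2 single_add) simp
qed (simp_all add: D2.zero \<Sigma>.zero add_mult_A mult_add_A D2.add \<Sigma>.add add_ac)

lemma D1_\<Sigma>: "a \<in> carrier A \<Longrightarrow> D1 (\<Sigma> a) = crossed_scale q (\<Sigma> (D1 a))"
  by (induction a rule: carrier_induct)
    (simp_all add: D1_single \<Sigma>_single D1.zero \<Sigma>.zero D1.add \<Sigma>.add crossed.scale_right_distrib
      d1.scale \<sigma>.scale d1_\<sigma> mult_ac)

text \<open>Although \<open>d2\<close> commutes with \<sigma>, D2 moves h to gh, where the scalar of
  \<Sigma> is smaller by the factor chi_1(g) = q.\<close>

lemma D2_\<Sigma>: "a \<in> carrier A \<Longrightarrow> D2 (\<Sigma> a) = crossed_scale q (\<Sigma> (D2 a))"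
  by (induction a rule: carrier_induct)
    (simp_all add: D2_single \<Sigma>_single D2.zero \<Sigma>.zero D2.add \<Sigma>.add crossed.scale_right_distrib
      d2.scale \<sigma>.scale d2_\<sigma> \<sigma>_s \<chi>1_inv \<chi>1_mult \<chi>1_g g cancel mult_ac)

text \<open>The q from \<open>d1_d2\<close> cancels against chi_1(g^-1), since D1 after D2 sees the
  component at gh.\<close>

lemma D1_D2: "a \<in> carrier A \<Longrightarrow> D1 (D2 a) = D2 (D1 a)"
  by (induction a rule: carrier_induct)
    (simp_all add: D2_single D1_single D2.zero D1.zero D2.add D1.add
      d2.scale d1.scale d1_s d1_d2 \<chi>1_inv \<chi>1_mult \<chi>1_g g cancel mult_ac)

lemma D1_closed: "a \<in> carrier A \<Longrightarrow> D1 a \<in> carrier A"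
  and \<Sigma>_closed: "a \<in> carrier A \<Longrightarrow> \<Sigma> a \<in> carrier A"
  and D2_closed: "a \<in> carrier A \<Longrightarrow> D2 a \<in> carrier A"
  by (induction a rule: carrier_induct;
      simp add: D1_single \<Sigma>_single D2_single D1.zero \<Sigma>.zero D2.zero D1.add \<Sigma>.add D2.add
        zero_carrier single_carrier add_carrier g)+

lemma D1_funpow: "(D1 ^^ n) 0 = 0" "(D1 ^^ n) (a + b) = (D1 ^^ n) a + (D1 ^^ n) b"
  by (induction n) (simp_all add: D1.zero D1.add)

lemma D2_funpow: "(D2 ^^ n) 0 = 0" "(D2 ^^ n) (a + b) = (D2 ^^ n) a + (D2 ^^ n) b"
  by (induction n) (simp_all add: D2.zero D2.add)

lemma D1_nilpotent: "a \<in> carrier A \<Longrightarrow> (D1 ^^ l) a = 0"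
proof (induction a rule: carrier_induct)
  case (single h r)
  have "(D1 ^^ n) (Poly_Mapping.single h r) =
      Poly_Mapping.single h (pscale (\<chi>1 (inv h) ^ n) ((d1 ^^ n) r))" for n
    by (induction n) (simp_all add: D1_single d1.scale mult.commute)
  thus ?case by (simp add: d1_nilpotent)
qed (simp_all add: D1_funpow)

lemma D2_nilpotent: "a \<in> carrier A \<Longrightarrow> (D2 ^^ l) a = 0"
proof (induction a rule: carrier_induct)
  case (single h r)
  \<comment> \<open>Each application changes the group element and the scalar, neither of which
    matters here; the powers of s pass through \<open>d2\<close>.\<close>
  have "\<exists>c k. (D2 ^^ n) (Poly_Mapping.single h r) =
      Poly_Mapping.single k (pscale c ((d2 ^^ n) r * s ^ n))" for n
  proof (induction n)
    case (Suc n)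
    then obtain c k where "(D2 ^^ n) (Poly_Mapping.single h r) =
        Poly_Mapping.single k (pscale c ((d2 ^^ n) r * s ^ n))" by blast
    hence "(D2 ^^ Suc n) (Poly_Mapping.single h r) =
        Poly_Mapping.single (g \<otimes> k) (pscale (\<alpha> g k * c) ((d2 ^^ Suc n) r * s ^ Suc n))"
      by (simp add: D2_single d2.scale d2_s_power mult_ac)
    thus ?case by blast
  qed (auto intro!: exI[of _ 1])
  from this[of l] show ?case by (auto simp: d2_nilpotent)
qed (simp_all add: D2_funpow)

sublocale skew: skew_derivation_pair crossed_scale A D1 D2 \<Sigma> q l
  by unfold_locales
    (use l q in \<open>simp_all add: D1_mult D2_mult D1_\<Sigma> D2_\<Sigma> D1_D2 D1_closed D2_closed \<Sigma>_closed
      D1_nilpotent D2_nilpotent D1.add D1.scale D2.add D2.scale \<Sigma>.add \<Sigma>.scale\<close>)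

section \<open>Nonvanishing of the cohomology class\<close>

lemma lookup_var_mult_eq_0:
  assumes "Poly_Mapping.lookup k i = 0"
  shows "Poly_Mapping.lookup (mono_poly (Poly_Mapping.single i 1) * r) k = 0"
proof (rule ccontr)
  assume "Poly_Mapping.lookup (mono_poly (Poly_Mapping.single i 1) * r) k \<noteq> 0"
  hence "k \<in> Poly_Mapping.keys (mono_poly (Poly_Mapping.single i 1) * r)"
    by (simp add: in_keys_iff)
  with keys_mult[of "mono_poly (Poly_Mapping.single i 1)" r] assms show False
    by (auto simp: mono_poly_def lookup_add split: if_splits)
qed

lemma not_coboundary: "\<not> hochschild_two_coboundary A (\<lambda>a b. D1 a \<otimes>\<^bsub>A\<^esub> D2 b)"
proof
  assume "hochschild_two_coboundary A (\<lambda>a b. D1 a \<otimes>\<^bsub>A\<^esub> D2 b)"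
  then obtain f where f: "linear_endo A f" and eq: "\<And>a b. a \<in> carrier A \<Longrightarrow> b \<in> carrier A \<Longrightarrow>
      D1 a \<otimes>\<^bsub>A\<^esub> D2 b = ((a \<otimes>\<^bsub>A\<^esub> f b) \<ominus>\<^bsub>A\<^esub> f (a \<otimes>\<^bsub>A\<^esub> b)) \<oplus>\<^bsub>A\<^esub> (f a \<otimes>\<^bsub>A\<^esub> b)"
    unfolding hochschild_two_coboundary_def by blast
  have f_closed: "f a \<in> carrier A" if "a \<in> carrier A" for a
    using f that by (auto simp: linear_endo_def)
  have eq': "D1 a \<otimes>\<^bsub>A\<^esub> D2 b = a \<otimes>\<^bsub>A\<^esub> f b - f (a \<otimes>\<^bsub>A\<^esub> b) + f a \<otimes>\<^bsub>A\<^esub> b"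
    if "a \<in> carrier A" "b \<in> carrier A" for a b
    using eq[OF that] that by (simp add: A.minus_eq_diff A.add_eq f_closed mult_closed_A)
  define x1 :: "'n sym_alg" where "x1 = mono_poly (Poly_Mapping.single i1 1)"
  define x2 :: "'n sym_alg" where "x2 = mono_poly (Poly_Mapping.single i2 1)"
  define X1 where "X1 = Poly_Mapping.single \<one> x1"
  define X2 where "X2 = Poly_Mapping.single \<one> x2"
  have X: "X1 \<in> carrier A" "X2 \<in> carrier A"
    by (simp_all add: X1_def X2_def single_carrier)
  have d: "d1 x1 = 1" "d1 x2 = 0" "d2 x2 = 1"
    using i1_i2 unfolding d1_def d2_def x1_def x2_def q_shift_var by (simp_all add: q_deriv_var del: One_nat_def)
  have "D1 X1 \<otimes>\<^bsub>A\<^esub> D2 X2 = Poly_Mapping.single g s"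
    using g by (simp add: X1_def X2_def D1_single D2_single d \<chi>1_one mult_single_A cocycle_one act_id)
  moreover have "D1 X2 \<otimes>\<^bsub>A\<^esub> D2 X1 = 0"
    by (simp add: X2_def D1_single d)
  \<comment> \<open>Commutativity makes f(X1 X2) cancel from the antisymmetrized identity, leaving
    only commutators.\<close>
  moreover have "X1 \<otimes>\<^bsub>A\<^esub> X2 = X2 \<otimes>\<^bsub>A\<^esub> X1"
    by (simp add: X1_def X2_def mult_single_A act_id mult.commute)
  ultimately have "Poly_Mapping.single g s =
      (X1 \<otimes>\<^bsub>A\<^esub> f X2 + f X1 \<otimes>\<^bsub>A\<^esub> X2) - (X2 \<otimes>\<^bsub>A\<^esub> f X1 + f X2 \<otimes>\<^bsub>A\<^esub> X1)"
    using eq'[OF X(1) X(2)] eq'[OF X(2) X(1)] by (simp add: algebra_simps)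
  hence "Poly_Mapping.lookup (Poly_Mapping.single g s) g = Poly_Mapping.lookup
      ((X1 \<otimes>\<^bsub>A\<^esub> f X2 + f X1 \<otimes>\<^bsub>A\<^esub> X2) - (X2 \<otimes>\<^bsub>A\<^esub> f X1 + f X2 \<otimes>\<^bsub>A\<^esub> X1)) g"
    by simp
  \<comment> \<open>As X1 and X2 are supported at the identity, only the components of f(X1) and
    f(X2) at g enter.\<close>
  moreover define u where "u = Poly_Mapping.lookup (f X2) g"
  moreover define v where "v = Poly_Mapping.lookup (f X1) g"
  ultimately have "s = (x1 * u + v * act g x2) - (x2 * v + u * act g x1)"
    using X f_closed
    by (simp add: lookup_minus lookup_add X1_def X2_def lookup_mult_one_left lookup_mult_one_right)
  \<comment> \<open>g only scales x_1 and x_2, so the right multiplications also stay in the ideal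
    of these variables.\<close>
  also have "\<dots> = x1 * (u - pscale (\<chi>1 g) u) + x2 * (pscale (\<chi>2 g) v - v)"
    using act_var_eigen[OF g] by (simp add: x1_def x2_def algebra_simps)
  finally have s: "s = x1 * (u - pscale (\<chi>1 g) u) + x2 * (pscale (\<chi>2 g) v - v)" .
  \<comment> \<open>A monomial of s contains neither x_1 nor x_2, whereas each monomial on the right
    of \<open>s\<close> contains one of them.\<close>
  have "Poly_Mapping.lookup s k = 0" for k
  proof (cases "k \<in> Poly_Mapping.keys s")
    case True
    hence "Poly_Mapping.lookup k i1 = 0" "Poly_Mapping.lookup k i2 = 0"
      using s_free by (auto simp: free_of_def)
    thus ?thesis
      by (subst s) (simp only: lookup_add x1_def x2_def lookup_var_mult_eq_0 add_0_left)
  qed (simp add: in_keys_iff)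
  hence "s = 0" by (intro poly_mapping_eqI) simp
  with s_nonzero show False ..
qed

end
theorem mainTheorem3:
  fixes G :: "('g, 'm) monoid_scheme"
    and scale :: "complex \<Rightarrow> 'v::ab_group_add \<Rightarrow> 'v"
    and x :: "'n::finite \<Rightarrow> 'v" and i1 i2 :: 'n
    and \<phi> :: "'g \<Rightarrow> 'v \<Rightarrow> 'v"
    and \<alpha> :: "'g \<Rightarrow> 'g \<Rightarrow> complex"
    and q :: complex and l :: nat and g :: 'g
    and s :: "'n sym_alg"
  assumes "group G" and "finite (carrier G)"
    and "Vector_Spaces.vector_space scale"
    and "inj x" and "\<not> Modules.module.dependent scale (range x)"
    and "Modules.module.span scale (range x) = UNIV"
    and "group_action G UNIV \<phi>"
    and "\<And>h. h \<in> carrier G \<Longrightarrow> Vector_Spaces.linear scale scale (\<phi> h)"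
    and "normalized_two_cocycle G \<alpha>"
    and "l \<ge> 2" and "primitive_root_of_unity l q"
    and "g \<in> carrier G" and "\<And>h. h \<in> carrier G \<Longrightarrow> g \<otimes>\<^bsub>G\<^esub> h = h \<otimes>\<^bsub>G\<^esub> g"
    and "i1 \<noteq> i2"
    and "\<phi> g (x i1) = scale q (x i1)"
    and "\<phi> g (x i2) = scale (inverse q) (x i2)"
    and "\<And>i. i \<noteq> i1 \<Longrightarrow> i \<noteq> i2 \<Longrightarrow> \<phi> g (x i) = x i"
    and "\<And>h. h \<in> carrier G \<Longrightarrow>
      \<phi> h ` Modules.module.span scale {x i1} \<subseteq> Modules.module.span scale {x i1}"
    and "\<And>h. h \<in> carrier G \<Longrightarrow>
      \<phi> h ` Modules.module.span scale {x i2} \<subseteq> Modules.module.span scale {x i2}"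
    and "\<chi>1 = character_on scale \<phi> (x i1)"
    and "\<chi>2 = character_on scale \<phi> (x i2)"
    and "s \<noteq> 0"
    and "\<And>k. k \<in> Poly_Mapping.keys s \<Longrightarrow>
      Poly_Mapping.lookup k i1 = 0 \<and> Poly_Mapping.lookup k i2 = 0"
    and "\<And>h. h \<in> carrier G \<Longrightarrow>
      sym_action scale x \<phi> h s = pscale (\<chi>1 h * \<chi>2 h * \<alpha> g h * inverse (\<alpha> h g)) s"
    and "A = crossed_product G \<alpha> (sym_action scale x \<phi>)"
    and "D1 = D1_op G \<chi>1 q i1"
    and "D2 = D2_op A q g s i1 i2"
    and "\<mu>1 = (\<lambda>a b. D1 a \<otimes>\<^bsub>A\<^esub> D2 b)"
    and "\<mu> = q_exp_product A l q D1 D2"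
  shows "hochschild_two_cocycle A \<mu>1 \<and>
    \<not> hochschild_two_coboundary A \<mu>1 \<and>
    formal_deformation A \<mu> \<and>
    (\<forall>a\<in>carrier A. \<forall>b\<in>carrier A. infinitesimal \<mu> a b = \<mu>1 a b) \<and>
    \<not> trivial_deformation A \<mu>"
proof -
  interpret G: group G by fact
  interpret V: vector_space scale by fact
  interpret \<phi>: group_action G UNIV \<phi> by fact
  interpret L: linear_group_action scale x G \<phi>
    by unfold_locales (use assms(4-6,8) in \<open>auto simp: Vector_Spaces.linear_iff\<close>)
  have s_free: "free_of i1 s" "free_of i2 s"
    using assms(23) by (auto simp: free_of_def)
  interpret Q: quantum_crossed_algebra scale x G \<phi> \<alpha> i1 i2 q l g s \<chi>1 \<chi>2
    by unfold_locales (rule assms s_free; assumption)+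
  have A: "A = Q.A" and D1: "D1 = Q.D1" and D2: "D2 = Q.D2"
    by (simp_all only: assms(25-27) Q.A_def Q.D1_def Q.D2_def)
  have \<mu>1: "\<mu>1 = (\<lambda>a b. Q.D1 a \<otimes>\<^bsub>Q.A\<^esub> Q.D2 b)" and \<mu>: "\<mu> = q_exp_product Q.A l q Q.D1 Q.D2"
    using assms(28,29) by (simp_all only: A D1 D2)
  have \<mu>_1: "\<mu> 1 = \<mu>1"
    unfolding \<mu> \<mu>1 by (intro ext Q.skew.q_exp_product_1)
  have deformation: "formal_deformation Q.A \<mu>"
    unfolding \<mu> by (rule Q.skew.formal_deformation_q_exp_product)
  have not_coboundary: "\<not> hochschild_two_coboundary Q.A \<mu>1"
    unfolding \<mu>1 by (rule Q.not_coboundary)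
  have "\<not> trivial_deformation Q.A \<mu>"
    using Q.A.coboundary_if_trivial[OF deformation] not_coboundary unfolding \<mu>_1 by blast
  moreover have "hochschild_two_cocycle Q.A \<mu>1"
    unfolding \<mu>1 by (rule Q.skew.hochschild_two_cocycle_skew)
  ultimately show ?thesis
    using deformation not_coboundary by (simp add: A infinitesimal_def \<mu>_1 del: One_nat_def)
qed

end
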